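(* Let $\lambda,\mu,\nu>0$, let $K$ be a finite positive integer and $0<M\le K$. Let $(Q^K_M(\infty),Z^K_M(\infty))$ denote the stationary version of the charging-station process with $K$ spaces and power capacity $M$ (see context), $C^K_M(\infty)=Q^K_M(\infty)-Z^K_M(\infty)$, and similarly $Q^\infty_M(\infty)$, $C^\infty_M(\infty)$ for infinitely many spaces and capacity $M$, and $C^K_K(\infty)$ for $K$ spaces and capacity $K$. Then $$\frac{\mathbb{E}[C^{\infty}_M(\infty)]}{\mathbb{E}[Q^{\infty}_M(\infty)]}\le \frac{\mathbb{E}[C^{K}_M(\infty)]}{\mathbb{E}[Q^{K}_M(\infty)]}\le \frac{\mathbb{E}[C^{K}_K(\infty)]}{\mathbb{E}[Q^{K}_M(\infty)]}.$$ Moreover, $$\frac{\mathbb{E}[Q^{K}_M(\infty)]-\mathbb{E}[Z_f(\infty)]}{\mathbb{E}[Q^{K}_M(\infty)]}\le \frac{\mathbb{E}[C^{K}_M(\infty)]}{\mathbb{E}[Q^{K}_M(\infty)]},$$ where $Z_f(\infty)$ is the stationary version of the full-parking-lot process $Z_f$ with the same $\mu,\nu,K,M$.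
   Context: Notation: $x\wedge y=\min\{x,y\}$. Charging-station process: for $\lambda,\mu,\nu>0$, $K\in\{1,2,\dots\}\cup\{\infty\}$ and $0<M\le K$ ($M$ finite), $(Q^K_M(t),Z^K_M(t))_{t\ge0}$ is the continuous-time Markov chain on $\{(q,z)\in\mathbb{Z}^2: 0\le z\le q\le K\}$ ($q<\infty$) with transitions: $(q,z)\to(q+1,z+1)$ at rate $\lambda$ if $q<K$ (an arriving electric vehicle (EV) is blocked if $q=K$); $(q,z)\to(q,z-1)$ at rate $\mu (z\wedge M)$ (an EV becomes fully charged); $(q,z)\to(q-1,z-1)$ at rate $\nu z$ (an uncharged EV departs); $(q,z)\to(q-1,z)$ at rate $\nu(q-z)$ (a fully charged EV departs). Here $Q$ is the total number of EVs, $Z$ the number of EVs not fully charged and $C=Q-Z$ the number of fully charged EVs. $X(\infty)$ denotes a random variable with the stationary distribution of a process $X$. Full-parking-lot process: $Z_f$ is the birth-death process on $\{0,1,\dots,K\}$ with birth rate $\nu(K-z)$ and death rate $\mu(z\wedge M)$ in state $z$. *)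

theory Defs
  imports "HOL-Probability.Probability" "HOL-Library.Extended_Nat"
begin

text \<open>
  \<open>P t x\<close> is the law at time \<open>t\<close> of a continuous-time Markov chain on \<open>S\<close> started in \<open>x\<close>;
  \<open>rate x y\<close> (for \<open>y \<noteq> x\<close>) is the rate of the transition from \<open>x\<close> to \<open>y\<close>.  The last clause says
  that the total rate of leaving \<open>x\<close> is the sum of these rates (the chain is conservative); the
  laws being honest probability distributions rules out explosion.  Values at negative times and
  at states outside \<open>S\<close> are irrelevant.
\<close>

definition ctmc_transition_function ::
  "'s set \<Rightarrow> ('s \<Rightarrow> 's \<Rightarrow> real) \<Rightarrow> (real \<Rightarrow> 's \<Rightarrow> 's pmf) \<Rightarrow> bool" where
  "ctmc_transition_function S rate P \<longleftrightarrow>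
     (\<forall>t\<ge>0. \<forall>x\<in>S. set_pmf (P t x) \<subseteq> S) \<and>
     (\<forall>x\<in>S. P 0 x = return_pmf x) \<and>
     (\<forall>s\<ge>0. \<forall>t\<ge>0. \<forall>x\<in>S. P (s + t) x = bind_pmf (P s x) (P t)) \<and>
     (\<forall>x\<in>S. \<forall>y\<in>S. x \<noteq> y \<longrightarrow>
        ((\<lambda>t. pmf (P t x) y / t) \<longlongrightarrow> rate x y) (at_right 0)) \<and>
     (\<forall>x\<in>S. ((\<lambda>t. (1 - pmf (P t x) x) / t) \<longlongrightarrow> (\<Sum>\<^sub>\<infinity>y\<in>S - {x}. rate x y)) (at_right 0))"

definition stationary_distribution ::
  "'s set \<Rightarrow> ('s \<Rightarrow> 's \<Rightarrow> real) \<Rightarrow> 's pmf \<Rightarrow> bool" where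
  "stationary_distribution S rate \<pi> \<longleftrightarrow>
     set_pmf \<pi> \<subseteq> S \<and>
     (\<exists>P. ctmc_transition_function S rate P \<and> (\<forall>t\<ge>0. bind_pmf \<pi> (P t) = \<pi>))"

text \<open>
  The charging station: \<open>q\<close> vehicles are present, \<open>z\<close> of them not fully charged.  The number \<open>K\<close>
  of spaces may be \<open>\<infinity>\<close>; the power capacity \<open>M\<close> is not required to be an integer.
\<close>

definition charging_states :: "enat \<Rightarrow> (nat \<times> nat) set" where
  "charging_states K = {(q, z). z \<le> q \<and> enat q \<le> K}"

fun charging_rate ::
  "real \<Rightarrow> real \<Rightarrow> real \<Rightarrow> enat \<Rightarrow> real \<Rightarrow> nat \<times> nat \<Rightarrow> nat \<times> nat \<Rightarrow> real" where
  "charging_rate lam \<mu> \<nu> K M (q, z) (q', z') =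
     (if enat q < K \<and> q' = Suc q \<and> z' = Suc z then lam
      else if q' = q \<and> z = Suc z' then \<mu> * min (real z) M
      else if q = Suc q' \<and> z = Suc z' then \<nu> * real z
      else if q = Suc q' \<and> z' = z then \<nu> * (real q - real z)
      else 0)"

definition full_lot_rate :: "real \<Rightarrow> real \<Rightarrow> nat \<Rightarrow> real \<Rightarrow> nat \<Rightarrow> nat \<Rightarrow> real" where
  "full_lot_rate \<mu> \<nu> K M z z' =
     (if z' = Suc z then \<nu> * (real K - real z)
      else if z = Suc z' then \<mu> * min (real z) M
      else 0)"

definition mean_Q :: "(nat \<times> nat) pmf \<Rightarrow> real" where
  "mean_Q \<pi> = measure_pmf.expectation \<pi> (\<lambda>(q, z). real q)"

definition mean_C :: "(nat \<times> nat) pmf \<Rightarrow> real" where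
  "mean_C \<pi> = measure_pmf.expectation \<pi> (\<lambda>(q, z). real q - real z)"

end

theory Submission
  imports Defs
begin

text \<open>
  Throughout, \<open>d z = \<mu> min(z,M) + \<nu> z\<close> is the rate at which uncharged vehicles disappear, and \<open>G\<close> is
  the generator of the charging station.  Everything rests on identities \<open>E (G f) = 0\<close> for suitably
  chosen \<open>f\<close>.

  \<^emph>\<open>Balance.\<close>  Letting time go to zero in the stationarity equation for one state, and
  keeping only finitely many sources of inflow, gives only that inflow is at most outflow
  (\<open>stationary_subinvariant\<close>).  Summed over all states with at most \<open>N\<close> vehicles, all flows cancel
  except those between the levels \<open>N\<close> and \<open>N + 1\<close>; hence \<open>\<nu> (N + 1) P(Q = N + 1) \<le> \<lambda> P(Q = N)\<close>.  So \<open>Q\<close>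
  has all moments, and the total defect up to level \<open>N\<close>, at most \<open>\<lambda> P(Q = N)\<close>, tends to zero: there is none.
  This gives \<open>E (G f) = 0\<close> for \<open>f\<close> of linear growth, for finite and infinite lots alike
  (\<open>expectation_generator\<close>).

  \<^emph>\<open>Second inequality.\<close>  The law of \<open>Q\<close> does not depend on the power capacity, and
  \<open>\<nu> E C = \<mu> E min(Z,M) \<le> \<mu> E Z = \<mu> (E Q - E C)\<close>, with equality if \<open>M = K\<close>.

  \<^emph>\<open>First inequality.\<close>  If vehicles are served first come first served, a vehicle that
  arrives to find \<open>z\<close> uncharged vehicles stays uncharged for a mean time \<open>w z = (z + 1) / d (z + 1)\<close>, so
  \<open>E Z = \<lambda> E [w Z; Q < K]\<close> and \<open>\<nu> E Q = \<lambda> P(Q < K)\<close>; that is,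
  \<open>E C / E Q = 1 - \<nu> E [w Z | Q < K]\<close>.  Put \<open>r j = P(Q < K, Z = j)\<close> for the finite lot and
  \<open>p j = P(Z = j)\<close> for the infinite one.  Counting crossings of a level of \<open>Z\<close> gives
  \<open>\<lambda> r j = d (j + 1) P(Z = j + 1) \<ge> d (j + 1) r (j + 1)\<close>, and \<open>\<lambda> p j = d (j + 1) p (j + 1)\<close>.  Hence \<open>r / p\<close>
  decreases while \<open>w\<close> increases, and Chebyshev's inequality compares the two conditional means.

  \<^emph>\<open>Third inequality.\<close>  It says \<open>E Z \<le> E Z\<^sub>f\<close>.  The key is that a departing vehicle
  leaves behind at least as many uncharged vehicles, in stochastic order, as an accepted arrival
  finds.  Indeed \<open>Q\<close> is reversible, so the
  past of \<open>Q\<close> before an arrival and before a departure can be coupled so that the second contains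
  one extra vehicle, the departing one, which is either present since its arrival or was spared
  by a departure from the full lot that happens only in the first.  The extra vehicle takes power
  from the others, so more of them are uncharged.  In terms of the generator: let \<open>V (q, z)\<close> be the
  expected integral of \<open>exp(- \<nu> t) u(Z\<^sub>t)\<close> up to the first time the lot is full, for an increasing
  \<open>u \<ge> 0\<close>.  Apply \<open>G\<close> to \<open>\<nu>\<close> times the sum, over the vehicles present, of \<open>V\<close> at the state of the other
  vehicles, minus \<open>\<lambda> V\<close>.  All terms cancel except the flow of \<open>u\<close> seen by arrivals, the one seen by
  departures, and the nonnegative effect of the extra vehicle (\<open>tagged_generator_bound\<close>).
  Together with the flow identity for arrivals this yields
  \<open>\<mu> E [min(Z,M) u(Z - 1)] \<le> \<nu> E [C u(Z)]\<close> (\<open>charged_flow_bound\<close>).  Finally let \<open>g\<close> be the slope of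
  a solution of the Poisson equation of the full lot, that is
  \<open>\<nu> (K - z) g z - \<mu> min(z,M) g (z - 1) = E Z\<^sub>f - z\<close>; it is nonnegative and increasing
  (\<open>full_lot_slope\<close>).  Taking \<open>u = g\<close> and using \<open>C \<le> K - Z\<close>, the mean of the left-hand side under the
  law of \<open>Z\<close> is nonnegative, that is, \<open>E Z\<^sub>f - E Z \<ge> 0\<close>.
\<close>

section \<open>Stationary laws and their balance equations\<close>

text \<open>
  Stationarity reads \<open>\<pi> y (1 - P t y y) = (\<Sum>x \<noteq> y. \<pi> x P t x y)\<close>.  Divided by \<open>t\<close>, its left-hand side
  converges as \<open>t\<close> tends to zero, but on the right the limit is taken over finitely many \<open>x\<close> only;
  this costs the equality.
\<close>

lemma stationary_subinvariant:
  assumes st: "stationary_distribution S rate \<pi>" and y: "y \<in> S"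
    and X: "finite X" "X \<subseteq> S - {y}"
  shows "(\<Sum>x\<in>X. pmf \<pi> x * rate x y) \<le> pmf \<pi> y * (\<Sum>\<^sub>\<infinity>x\<in>S - {y}. rate y x)"
proof -
  obtain P where P: "ctmc_transition_function S rate P" "\<And>t. t \<ge> 0 \<Longrightarrow> bind_pmf \<pi> (P t) = \<pi>"
    using st unfolding stationary_distribution_def by blast
  have lim_in: "((\<lambda>t. pmf (P t x) y / t) \<longlongrightarrow> rate x y) (at_right 0)" if "x \<in> X" for x
    using P(1) that X y unfolding ctmc_transition_function_def by blast
  have lim_out: "((\<lambda>t. (1 - pmf (P t y) y) / t) \<longlongrightarrow> (\<Sum>\<^sub>\<infinity>x\<in>S - {y}. rate y x)) (at_right 0)"
    using P(1) y unfolding ctmc_transition_function_def by blast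
  have ineq: "(\<Sum>x\<in>X. pmf \<pi> x * (pmf (P t x) y / t)) \<le> pmf \<pi> y * ((1 - pmf (P t y) y) / t)"
    if t: "t > 0" for t
  proof -
    let ?F = "insert y X"
    have int: "integrable (measure_pmf \<pi>) (\<lambda>x. indicator ?F x * pmf (P t x) y)"
              "integrable (measure_pmf \<pi>) (\<lambda>x. pmf (P t x) y)"
      by (rule measure_pmf.integrable_const_bound[where B=1];
          auto simp: pmf_le_1 indicator_def)+
    have "(\<Sum>x\<in>?F. pmf (P t x) y * pmf \<pi> x) = (\<Sum>x\<in>?F. (indicator ?F x * pmf (P t x) y) * pmf \<pi> x)"
      by (intro sum.cong) auto
    also have "\<dots> = (\<integral>x. indicator ?F x * pmf (P t x) y \<partial>measure_pmf \<pi>)"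
      by (rule integral_measure_pmf_real[symmetric]) (use X in \<open>auto simp: indicator_def split: if_splits\<close>)
    also have "\<dots> \<le> (\<integral>x. pmf (P t x) y \<partial>measure_pmf \<pi>)"
      by (rule integral_mono[OF int]) (auto simp: indicator_def)
    also have "\<dots> = pmf (bind_pmf \<pi> (P t)) y" by (simp add: pmf_bind)
    also have "\<dots> = pmf \<pi> y" using P(2) t by simp
    finally have "(\<Sum>x\<in>X. pmf \<pi> x * pmf (P t x) y) \<le> pmf \<pi> y * (1 - pmf (P t y) y)"
      using X by (subst (asm) sum.insert) (auto simp: algebra_simps)
    then show ?thesis
      using t by (simp add: sum_divide_distrib[symmetric] divide_right_mono)
  qed
  show ?thesis
  proof (rule tendsto_le)
    show "((\<lambda>t. pmf \<pi> y * ((1 - pmf (P t y) y) / t)) \<longlongrightarrow>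
        pmf \<pi> y * (\<Sum>\<^sub>\<infinity>x\<in>S - {y}. rate y x)) (at_right 0)"
      by (intro tendsto_intros lim_out)
    show "((\<lambda>t. \<Sum>x\<in>X. pmf \<pi> x * (pmf (P t x) y / t)) \<longlongrightarrow> (\<Sum>x\<in>X. pmf \<pi> x * rate x y)) (at_right 0)"
      by (intro tendsto_intros lim_in)
    show "\<forall>\<^sub>F t in at_right 0. (\<Sum>x\<in>X. pmf \<pi> x * (pmf (P t x) y / t)) \<le> pmf \<pi> y * ((1 - pmf (P t y) y) / t)"
      unfolding eventually_at_right_field using ineq zero_less_one by blast
  qed simp
qed

text \<open>
  On finitely many states, total inflow and total outflow are the same double sum, so none of
  the inequalities between inflow and outflow can be strict.
\<close>

lemma stationary_finite_balance:
  fixes h :: "'s \<Rightarrow> real"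
  assumes st: "stationary_distribution S rate \<pi>" and fin: "finite S"
  shows "measure_pmf.expectation \<pi> (\<lambda>x. \<Sum>y\<in>S - {x}. rate x y * (h y - h x)) = 0"
proof -
  define inflow where "inflow y = (\<Sum>x\<in>S - {y}. pmf \<pi> x * rate x y)" for y
  define outflow where "outflow y = pmf \<pi> y * (\<Sum>x\<in>S - {y}. rate y x)" for y
  have le: "inflow y \<le> outflow y" if "y \<in> S" for y
    using stationary_subinvariant[OF st that, of "S - {y}"] fin
    unfolding inflow_def outflow_def by simp
  have exch: "(\<Sum>y\<in>S. \<Sum>x\<in>S - {y}. f x y) = (\<Sum>x\<in>S. \<Sum>y\<in>S - {x}. f x y)" for f :: "'s \<Rightarrow> 's \<Rightarrow> real"
  proof -
    have "(\<Sum>y\<in>S. \<Sum>x\<in>S - {y}. f x y) = (\<Sum>y\<in>S. \<Sum>x\<in>S. if x = y then 0 else f x y)"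
      using fin by (intro sum.cong refl sum.mono_neutral_cong_left) auto
    also have "\<dots> = (\<Sum>x\<in>S. \<Sum>y\<in>S. if x = y then 0 else f x y)" by (rule sum.swap)
    also have "\<dots> = (\<Sum>x\<in>S. \<Sum>y\<in>S - {x}. f x y)"
      using fin by (intro sum.cong refl sum.mono_neutral_cong_right) auto
    finally show ?thesis .
  qed
  have "(\<Sum>y\<in>S. inflow y) = (\<Sum>y\<in>S. outflow y)"
    using exch[of "\<lambda>x y. pmf \<pi> x * rate x y"]
    unfolding inflow_def outflow_def sum_distrib_left by simp
  then have "(\<Sum>y\<in>S. outflow y - inflow y) = 0" by (simp add: sum_subtractf)
  then have eq: "inflow y = outflow y" if "y \<in> S" for y
    using le that fin by (subst (asm) sum_nonneg_eq_0_iff) auto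
  have "measure_pmf.expectation \<pi> (\<lambda>x. \<Sum>y\<in>S - {x}. rate x y * (h y - h x)) =
      (\<Sum>x\<in>S. (\<Sum>y\<in>S - {x}. rate x y * (h y - h x)) * pmf \<pi> x)"
    by (rule integral_measure_pmf_real[OF fin])
      (use st in \<open>auto simp: stationary_distribution_def\<close>)
  also have "\<dots> = (\<Sum>x\<in>S. \<Sum>y\<in>S - {x}. pmf \<pi> x * rate x y * h y) - (\<Sum>x\<in>S. h x * outflow x)"
    unfolding outflow_def sum_distrib_left sum_distrib_right sum_subtractf[symmetric]
    by (intro sum.cong refl) (simp add: algebra_simps)
  also have "(\<Sum>x\<in>S. \<Sum>y\<in>S - {x}. pmf \<pi> x * rate x y * h y) = (\<Sum>y\<in>S. h y * inflow y)"
    unfolding inflow_def sum_distrib_left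
    by (subst exch[symmetric]) (simp add: mult_ac)
  also have "\<dots> = (\<Sum>x\<in>S. h x * outflow x)" using eq by simp
  finally show ?thesis by simp
qed

section \<open>Elementary facts on minima, fixed points and distributions\<close>

text \<open>
  The charging rate per uncharged vehicle, \<open>min z M / z\<close>, decreases with the number \<open>z\<close> of
  uncharged vehicles.  This is why waiting times increase with \<open>z\<close>, and why a tagged vehicle slows
  down the charging of the others.
\<close>

lemma min_ratio_decreasing:
  fixes M :: real
  assumes "M \<ge> 0"
  shows "real z * min (real (Suc z)) M \<le> real (Suc z) * min (real z) M"
proof (cases "real z \<le> M")
  case True
  have "real z * min (real (Suc z)) M \<le> real z * real (Suc z)" by (intro mult_left_mono) auto
  then show ?thesis using True by (simp add: min_def mult.commute)
qed (use assms in \<open>auto simp: min_def algebra_simps\<close>)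

text \<open>
  Discounted value functions arise as limits of the iterates of their one-step operator.
  Properties of the iterates that survive pointwise limits are inherited by the value function,
  which is how monotonicity in the number of uncharged vehicles is obtained.
\<close>

lemma monotone_fixed_point:
  fixes T :: "('s \<Rightarrow> real) \<Rightarrow> 's \<Rightarrow> real"
  assumes mono: "\<And>v w x. (\<And>y. v y \<le> w y) \<Longrightarrow> T v x \<le> T w x"
    and cont: "\<And>X v x. (\<And>y. (\<lambda>n. X n y) \<longlonglongrightarrow> v y) \<Longrightarrow> (\<lambda>n. T (X n) x) \<longlonglongrightarrow> T v x"
    and zero: "\<And>x. 0 \<le> T (\<lambda>_. 0) x" and B: "\<And>x. T (\<lambda>_. B) x \<le> B" "0 \<le> B"
    and P_zero: "P (\<lambda>_. 0)" and P_step: "\<And>v. P v \<Longrightarrow> (\<And>x. 0 \<le> v x) \<Longrightarrow> P (T v)"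
    and P_lim: "\<And>X v. (\<And>n. P (X n)) \<Longrightarrow> (\<And>x. (\<lambda>n. X n x) \<longlonglongrightarrow> v x) \<Longrightarrow> P v"
  shows "\<exists>v. T v = v \<and> (\<forall>x. 0 \<le> v x) \<and> (\<forall>x. v x \<le> B) \<and> P v"
proof -
  define X where "X n = (T ^^ n) (\<lambda>_. 0)" for n
  have X_Suc: "X (Suc n) = T (X n)" and X_0: "X 0 = (\<lambda>_. 0)" for n by (simp_all add: X_def)
  have step: "X n x \<le> X (Suc n) x" for n x
  proof (induction n arbitrary: x)
    case (Suc n)
    then show ?case unfolding X_Suc[of n] X_Suc[of "Suc n"] by (intro mono)
  qed (simp add: X_Suc X_0 zero)
  then have incseq: "incseq (\<lambda>n. X n x)" for x by (intro incseq_SucI)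
  have nonneg: "0 \<le> X n x" for n x using incseqD[OF incseq, of 0 n x] by (simp add: X_0)
  have upper: "X n x \<le> B" for n x
  proof (induction n arbitrary: x)
    case (Suc n)
    then show ?case unfolding X_Suc using mono[of "X n" "\<lambda>_. B" x] B(1)[of x] by simp
  qed (simp add: X_0 B)
  have "\<exists>l. (\<lambda>n. X n x) \<longlonglongrightarrow> l" for x
    using incseq_convergent[OF incseq] upper by metis
  then obtain v where v: "\<And>x. (\<lambda>n. X n x) \<longlonglongrightarrow> v x" by metis
  have "T v x = v x" for x
    using cont[OF v] LIMSEQ_Suc[OF v, of x] unfolding X_Suc by (rule LIMSEQ_unique)
  moreover have "P (X n)" for n
    by (induction n) (auto simp: X_0 X_Suc P_zero nonneg intro: P_step)
  moreover have "0 \<le> v x" "v x \<le> B" for x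
    using v[of x] nonneg upper by (auto intro: LIMSEQ_le_const LIMSEQ_le_const2)
  ultimately show ?thesis using P_lim[OF _ v] by (intro exI[of _ v]) auto
qed

lemma pmf_nat_eqI:
  fixes p p' :: "nat pmf"
  assumes "\<And>n. a (Suc n) * pmf p (Suc n) = b n * pmf p n"
    and "\<And>n. a (Suc n) * pmf p' (Suc n) = b n * pmf p' n"
    and a: "\<And>n. a (Suc n) \<noteq> 0"
  shows "p = p'"
proof -
  have cross: "pmf p n * pmf p' 0 = pmf p' n * pmf p 0" for n
  proof (induction n)
    case (Suc n)
    have "a (Suc n) * (pmf p (Suc n) * pmf p' 0) = b n * (pmf p n * pmf p' 0)"
      using assms(1)[of n] by simp
    also have "\<dots> = a (Suc n) * (pmf p' (Suc n) * pmf p 0)"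
      using assms(2)[of n] Suc by (simp add: mult.assoc[symmetric])
    finally show ?case using a[of n] by simp
  qed simp
  have "pmf p' 0 = (\<integral>n. pmf p n * pmf p' 0 \<partial>count_space UNIV)" by (simp add: integral_pmf)
  also have "\<dots> = pmf p 0" unfolding cross by (simp add: integral_pmf)
  finally have eq: "pmf p' 0 = pmf p 0" .
  have "pmf p 0 \<noteq> 0"
  proof
    assume "pmf p 0 = 0"
    then have "pmf p n = 0" for n
    proof (induction n)
      case (Suc n)
      then show ?case using assms(1)[of n] a[of n] by simp
    qed
    then show False using set_pmf_not_empty[of p] by (auto simp: set_pmf_eq)
  qed
  then show ?thesis using cross eq by (intro pmf_eqI) simp
qed

text \<open>
  Chebyshev's association inequality: if \<open>k\<close> is the first point at which \<open>w\<close> reaches its mean \<open>c\<close>,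
  then \<open>(x n - x k) (w n - c) \<le> 0\<close> for all \<open>n\<close>.
\<close>

lemma expectation_antimono_mono:
  fixes p :: "nat pmf" and x w :: "nat \<Rightarrow> real"
  assumes x: "antimono x" and w: "mono w"
    and int: "integrable (measure_pmf p) x" "integrable (measure_pmf p) w"
      "integrable (measure_pmf p) (\<lambda>n. x n * w n)"
  shows "measure_pmf.expectation p (\<lambda>n. x n * w n) \<le>
    measure_pmf.expectation p x * measure_pmf.expectation p w"
proof -
  let ?E = "measure_pmf.expectation p"
  define c where "c = ?E w"
  have "\<exists>n. w n \<ge> c"
  proof (rule ccontr)
    assume "\<not> (\<exists>n. w n \<ge> c)"
    then have less: "w n < c" for n by (simp add: not_le)
    have "?E w < ?E (\<lambda>_. c)"
      by (rule measure_pmf.integral_less_AE_space) (use int less in \<open>auto simp: measure_pmf.emeasure_space_1\<close>)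
    then show False by (simp add: c_def)
  qed
  define k where "k = (LEAST n. w n \<ge> c)"
  have k: "w k \<ge> c" unfolding k_def by (rule LeastI_ex) fact
  have sign: "x n * (w n - c) \<le> x k * (w n - c)" for n
  proof (cases "n < k")
    case True
    then have "w n < c" using not_less_Least[of n "\<lambda>n. w n \<ge> c"] unfolding k_def by auto
    moreover have "x k \<le> x n" using antimonoD[OF x, of n k] True by simp
    ultimately show ?thesis by (intro mult_right_mono_neg) auto
  next
    case False
    then have "w n \<ge> c" "x n \<le> x k"
      using k monoD[OF w, of k n] antimonoD[OF x, of k n] by auto
    then show ?thesis by (intro mult_right_mono) auto
  qed
  have "?E (\<lambda>n. x n * w n) - ?E x * c = ?E (\<lambda>n. x n * (w n - c))"
    using int by (simp add: right_diff_distrib)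
  also have "\<dots> \<le> ?E (\<lambda>n. x k * (w n - c))"
    using int by (intro integral_mono sign) (auto simp: right_diff_distrib)
  also have "\<dots> = 0" using int by (simp add: c_def)
  finally show ?thesis by (simp add: c_def)
qed

section \<open>The generator of the charging station\<close>

text \<open>
  The truncated differences \<open>q - 1\<close> and \<open>z - 1\<close> only matter at \<open>q = 0\<close> or \<open>z = 0\<close>, where on the state
  space the corresponding rates vanish.
\<close>

fun charging_generator ::
  "real \<Rightarrow> real \<Rightarrow> real \<Rightarrow> enat \<Rightarrow> real \<Rightarrow> (nat \<times> nat \<Rightarrow> real) \<Rightarrow> nat \<times> nat \<Rightarrow> real" where
  "charging_generator lam \<mu> \<nu> K M f (q, z) =
     (if enat q < K then lam * (f (Suc q, Suc z) - f (q, z)) else 0)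
     + \<mu> * min (real z) M * (f (q, z - 1) - f (q, z))
     + \<nu> * real z * (f (q - 1, z - 1) - f (q, z))
     + \<nu> * (real q - real z) * (f (q - 1, z) - f (q, z))"

locale charging_station =
  fixes lam \<mu> \<nu> :: real and K :: enat and M :: real and \<pi> :: "(nat \<times> nat) pmf"
  assumes lam: "lam > 0" and mu: "\<mu> > 0" and nu: "\<nu> > 0" and M: "M > 0"
    and stationary: "stationary_distribution (charging_states K) (charging_rate lam \<mu> \<nu> K M) \<pi>"
begin

abbreviation "S \<equiv> charging_states K"
abbreviation "rate \<equiv> charging_rate lam \<mu> \<nu> K M"
abbreviation "G \<equiv> charging_generator lam \<mu> \<nu> K M"
abbreviation "E \<equiv> measure_pmf.expectation \<pi>"

lemma support: "x \<in> set_pmf \<pi> \<Longrightarrow> x \<in> S"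
  using stationary unfolding stationary_distribution_def by auto

lemma charging_rate_split:
  assumes "(q, z) \<in> S"
  shows "rate (q, z) y * c =
     (if y = (Suc q, Suc z) then (if enat q < K then lam * c else 0) else 0)
     + (if y = (q, z - 1) then \<mu> * min (real z) M * c else 0)
     + (if y = (q - 1, z - 1) then \<nu> * real z * c else 0)
     + (if y = (q - 1, z) then \<nu> * (real q - real z) * c else 0)"
  using assms M by (cases y) (auto simp: charging_states_def)

lemma charging_generator_eq_sum:
  assumes "(q, z) \<in> S"
  shows "G f (q, z) = (\<Sum>y\<in>{..Suc q} \<times> {..Suc z}. rate (q, z) y * (f y - f (q, z)))"
  unfolding charging_rate_split[OF assms] sum.distrib
  by (simp add: le_SucI)

lemma rate_eq_0_far: "y \<notin> {..Suc q} \<times> {..Suc z} \<Longrightarrow> rate (q, z) y = 0"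
  by (cases y) auto

lemma rate_eq_0_outside:
  assumes "(q, z) \<in> S" "y \<notin> S \<or> y = (q, z)"
  shows "rate (q, z) y = 0"
proof -
  obtain q' z' where y: "y = (q', z')" by (cases y)
  have K: "enat q \<le> K" and z: "z \<le> q" using assms by (auto simp: charging_states_def)
  show ?thesis
  proof (cases "y = (q, z)")
    case False
    with assms(2) have out: "\<not> (z' \<le> q' \<and> enat q' \<le> K)"
      by (auto simp: charging_states_def y)
    have up: "\<not> (enat q < K \<and> q' = Suc q \<and> z' = Suc z)"
      using out z by (metis Suc_ile_eq Suc_le_mono)
    have "\<not> q' \<le> q" if "z' \<le> q'"
      using out that K by (meson enat_ord_simps(1) order_trans)
    then have "\<not> (q' = q \<and> z = Suc z') \<and> \<not> (q = Suc q' \<and> z = Suc z') \<and>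
        (q = Suc q' \<and> z' = z \<longrightarrow> q = z)"
      using z by linarith
    then show ?thesis using up unfolding y by auto
  qed (simp add: y)
qed

lemma total_rate:
  assumes "(q, z) \<in> S"
  shows "(\<Sum>\<^sub>\<infinity>y\<in>S - {(q, z)}. rate (q, z) y) = (\<Sum>y\<in>{..Suc q} \<times> {..Suc z}. rate (q, z) y)"
proof -
  have "(\<Sum>\<^sub>\<infinity>y\<in>S - {(q, z)}. rate (q, z) y) = (\<Sum>\<^sub>\<infinity>y\<in>{..Suc q} \<times> {..Suc z}. rate (q, z) y)"
  proof (rule infsum_cong_neutral)
    fix y assume "y \<in> ({..Suc q} \<times> {..Suc z}) - (S - {(q, z)})"
    then have "y \<notin> S \<or> y = (q, z)" by auto
    then show "rate (q, z) y = 0" by (rule rate_eq_0_outside[OF assms])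
  next
    fix y assume "y \<in> (S - {(q, z)}) - ({..Suc q} \<times> {..Suc z})"
    then have "y \<notin> {..Suc q} \<times> {..Suc z}" by auto
    then show "rate (q, z) y = 0" by (rule rate_eq_0_far)
  qed simp
  then show ?thesis by simp
qed

lemma generator_cong:
  assumes "x \<in> S" "\<And>y. y \<in> S \<Longrightarrow> f y = g y"
  shows "G f x = G g x"
proof -
  obtain q z where x: "x = (q, z)" by (cases x)
  have "rate (q, z) y * (f y - f (q, z)) = rate (q, z) y * (g y - g (q, z))" for y
  proof (cases "y \<in> S")
    case False
    then show ?thesis using rate_eq_0_outside[of q z y] assms(1) x by simp
  qed (use assms x in simp)
  then show ?thesis using assms(1) unfolding x by (simp only: charging_generator_eq_sum)
qed

lemma generator_sum:
  "G (\<lambda>x. \<Sum>y\<in>A. c y * e y x) x = (\<Sum>y\<in>A. c y * G (e y) x)"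
proof (induction A rule: infinite_finite_induct)
  case (insert a A)
  then show ?case by (cases x) (auto simp: algebra_simps)
qed (cases x; simp)+

lemma generator_indicator:
  assumes "x \<in> S"
  shows "G (indicator {y}) x =
    (if x = y then - (\<Sum>\<^sub>\<infinity>w\<in>S - {x}. rate x w) else rate x y)"
proof -
  obtain q z where x: "x = (q, z)" by (cases x)
  let ?B = "{..Suc q} \<times> {..Suc z}"
  have G: "G (indicator {y}) x = (\<Sum>w\<in>?B. rate x w * (indicator {y} w - indicator {y} x))"
    using charging_generator_eq_sum assms unfolding x by blast
  show ?thesis
  proof (cases "x = y")
    case True
    have "rate x x = 0" using rate_eq_0_outside assms x by blast
    then have "rate x w * (indicator {y} w - indicator {y} x) = - rate x w" for w
      using True by (auto simp: indicator_def)
    then have "G (indicator {y}) x = - (\<Sum>w\<in>?B. rate x w)" unfolding G by (simp add: sum_negf)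
    then show ?thesis using True total_rate[of q z] assms x by simp
  next
    case False
    then have "rate x w * (indicator {y} w - indicator {y} x) = (if w = y then rate x y else 0)" for w
      by (auto simp: indicator_def)
    then have "G (indicator {y}) x = (if y \<in> ?B then rate x y else 0)"
      unfolding G by (simp del: mem_Sigma_iff)
    then show ?thesis using False rate_eq_0_far[of y q z] unfolding x by auto
  qed
qed

lemma finite_support_integrable:
  fixes g :: "nat \<times> nat \<Rightarrow> real"
  assumes "finite X" "\<And>x. x \<in> S \<Longrightarrow> g x \<noteq> 0 \<Longrightarrow> x \<in> X"
  shows "integrable (measure_pmf \<pi>) g"
proof -
  have "integrable (measure_pmf \<pi>) (\<lambda>x. \<Sum>a\<in>X. g a * indicator {a} x)"
    by (intro Bochner_Integration.integrable_sum integrable_mult_right)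
       (auto intro!: measure_pmf.integrable_const_bound[where B=1])
  moreover have "AE x in measure_pmf \<pi>. (\<Sum>a\<in>X. g a * indicator {a} x) = g x"
  proof (rule AE_pmfI)
    fix x assume "x \<in> set_pmf \<pi>"
    have "(\<Sum>a\<in>X. g a * indicator {a} x) = (\<Sum>a\<in>X. if a = x then g x else 0)"
      by (intro sum.cong) (auto simp: indicator_def)
    then have "(\<Sum>a\<in>X. g a * indicator {a} x) = (if x \<in> X then g x else 0)"
      using assms(1) by (simp add: sum.delta)
    then show "(\<Sum>a\<in>X. g a * indicator {a} x) = g x"
      using assms(2)[OF support[OF \<open>x \<in> set_pmf \<pi>\<close>]] by auto
  qed
  ultimately show ?thesis by (subst (asm) integrable_cong_AE) auto
qed

lemma generator_indicator_support:
  assumes "x \<in> S" "G (indicator {(q, z)}) x \<noteq> 0"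
  shows "x \<in> ({..Suc q} \<times> {..Suc z})"
proof (cases "x = (q, z)")
  case False
  then have "rate x (q, z) \<noteq> 0" using assms generator_indicator by metis
  then show ?thesis by (cases x) (auto split: if_splits)
qed auto

lemma generator_indicator_integrable: "integrable (measure_pmf \<pi>) (G (indicator {y}))"
proof (cases y)
  case (Pair q z)
  show ?thesis unfolding Pair
    by (rule finite_support_integrable[OF _ generator_indicator_support]) auto
qed

lemma expectation_generator_indicator_nonpos:
  assumes y: "y \<in> S"
  shows "E (G (indicator {y})) \<le> 0"
proof -
  obtain q z where yq: "y = (q, z)" by (cases y)
  define X where "X = ({..Suc q} \<times> {..Suc z}) \<inter> S"
  have X: "finite X" "y \<in> X" using y unfolding X_def yq by auto
  have "E (G (indicator {y})) = (\<Sum>x\<in>X. G (indicator {y}) x * pmf \<pi> x)"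
    by (rule integral_measure_pmf_real[OF X(1)])
       (use support generator_indicator_support in \<open>auto simp: X_def yq\<close>)
  also have "\<dots> = (\<Sum>x\<in>X - {y}. pmf \<pi> x * rate x y) - pmf \<pi> y * (\<Sum>\<^sub>\<infinity>w\<in>S - {y}. rate y w)"
    by (subst sum.remove[OF X]) (auto simp: generator_indicator y X_def intro!: sum.cong)
  also have "\<dots> \<le> 0"
    using stationary_subinvariant[OF stationary y, of "X - {y}"] X unfolding X_def by auto
  finally show ?thesis .
qed

text \<open>
  The sets \<open>lower N\<close> are finite and exhaust the state space.  Flows between states of \<open>lower N\<close>
  cancel, and a transition changes the number of vehicles by at most one, so the net flow into the
  set is read off from the levels \<open>N\<close> and \<open>N + 1\<close>.
\<close>

definition lower :: "nat \<Rightarrow> (nat \<times> nat) set" where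
  "lower N = {x \<in> S. fst x \<le> N}"

lemma finite_lower: "finite (lower N)"
  by (rule finite_subset[of _ "{..N} \<times> {..N}"]) (auto simp: lower_def charging_states_def)

lemma generator_truncated:
  "G (\<lambda>x. if x \<in> lower N then f x else 0) x = (\<Sum>y\<in>lower N. f y * G (indicator {y}) x)"
proof -
  have "(\<Sum>y\<in>lower N. f y * indicator {y} x) = (\<Sum>y\<in>lower N. if y = x then f x else 0)" for x
    by (intro sum.cong) (auto simp: indicator_def)
  then have eq: "(\<lambda>x. if x \<in> lower N then f x else 0) = (\<lambda>x. \<Sum>y\<in>lower N. f y * indicator {y} x)"
    using finite_lower by (simp add: fun_eq_iff)
  show ?thesis by (subst eq) (rule generator_sum)
qed

lemma expectation_generator_truncated:
  "E (G (\<lambda>x. if x \<in> lower N then f x else 0)) = (\<Sum>y\<in>lower N. f y * E (G (indicator {y})))"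
  unfolding generator_truncated using generator_indicator_integrable by simp

definition pQ :: "nat \<Rightarrow> real" where
  "pQ n = measure_pmf.prob \<pi> {x. fst x = n}"

lemma level_flow:
  "(\<Sum>y\<in>lower N. E (G (indicator {y}))) =
     \<nu> * real (Suc N) * pQ (Suc N) - (if enat N < K then lam else 0) * pQ N"
proof -
  have "(\<Sum>y\<in>lower N. E (G (indicator {y}))) = E (G (\<lambda>x. if x \<in> lower N then 1 else 0))"
    using expectation_generator_truncated[of N "\<lambda>_. 1"] by simp
  also have "\<dots> = E (\<lambda>x. \<nu> * real (Suc N) * indicator {x. fst x = Suc N} x
      - (if enat N < K then lam else 0) * indicator {x. fst x = N} x)"
  proof (rule integral_cong_AE)
    show "AE x in measure_pmf \<pi>. G (\<lambda>x. if x \<in> lower N then 1 else 0) x =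
      \<nu> * real (Suc N) * indicator {x. fst x = Suc N} x
      - (if enat N < K then lam else 0) * indicator {x. fst x = N} x"
    proof (rule AE_pmfI)
      fix x assume "x \<in> set_pmf \<pi>"
      then have x: "x \<in> S" by (rule support)
      obtain q z where xq: "x = (q, z)" by (cases x)
      have "G (\<lambda>x. if x \<in> lower N then 1 else 0) x = G (\<lambda>x. if fst x \<le> N then 1 else 0) x"
        by (rule generator_cong[OF x]) (auto simp: lower_def)
      also have "\<dots> = \<nu> * real (Suc N) * indicator {x. fst x = Suc N} x
        - (if enat N < K then lam else 0) * indicator {x. fst x = N} x"
      proof -
        consider "q < N" | "q = N" | "q = Suc N" | "q > Suc N" by linarith
        then show ?thesis unfolding xq by cases (auto simp: algebra_simps)
      qed
      finally show "G (\<lambda>x. if x \<in> lower N then 1 else 0) x =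
        \<nu> * real (Suc N) * indicator {x. fst x = Suc N} x
        - (if enat N < K then lam else 0) * indicator {x. fst x = N} x" .
    qed
  qed auto
  also have "\<dots> = \<nu> * real (Suc N) * pQ (Suc N) - (if enat N < K then lam else 0) * pQ N"
    unfolding pQ_def
    by (subst Bochner_Integration.integral_diff)
       (auto intro!: integrable_mult_right measure_pmf.integrable_const_bound[where B=1])
  finally show ?thesis .
qed

lemma pQ_bounds: "0 \<le> pQ n" "pQ n \<le> 1"
  unfolding pQ_def by auto

lemma pQ_step: "\<nu> * real (Suc N) * pQ (Suc N) \<le> lam * pQ N"
proof -
  have "(\<Sum>y\<in>lower N. E (G (indicator {y}))) \<le> 0"
    by (intro sum_nonpos expectation_generator_indicator_nonpos) (auto simp: lower_def)
  moreover have "(if enat N < K then lam else 0) * pQ N \<le> lam * pQ N"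
    using lam pQ_bounds by (auto intro: mult_right_mono)
  ultimately show ?thesis unfolding level_flow by linarith
qed

text \<open>
  Each defect of balance is nonpositive, and the sum of all of them up to level \<open>N\<close> is at least
  \<open>- \<lambda> P(Q = N)\<close>, which is of order \<open>1 / N\<close> because \<open>\<nu> N P(Q = N) \<le> \<lambda> P(Q = N - 1)\<close>.
\<close>

lemma expectation_generator_indicator:
  assumes y: "y \<in> S"
  shows "E (G (indicator {y})) = 0"
proof -
  let ?e = "E (G (indicator {y}))"
  have "- ?e * (\<nu> * real (Suc n)) \<le> lam * lam" if n: "Suc n \<ge> fst y" for n
  proof -
    have "y \<in> lower (Suc n)" using y n by (auto simp: lower_def)
    then have "(\<Sum>y\<in>lower (Suc n). E (G (indicator {y}))) \<le> ?e"
      using expectation_generator_indicator_nonpos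
      by (subst sum.remove[OF finite_lower]) (auto intro!: sum_nonpos simp: lower_def)
    moreover have "0 \<le> \<nu> * real (Suc (Suc n)) * pQ (Suc (Suc n))"
      using nu pQ_bounds by (intro mult_nonneg_nonneg) auto
    moreover have "(if enat (Suc n) < K then lam else 0) * pQ (Suc n) \<le> lam * pQ (Suc n)"
      using lam pQ_bounds by (auto intro: mult_right_mono)
    ultimately have "- ?e \<le> lam * pQ (Suc n)" unfolding level_flow by linarith
    then have "- ?e * (\<nu> * real (Suc n)) \<le> lam * pQ (Suc n) * (\<nu> * real (Suc n))"
      using nu by (intro mult_right_mono) auto
    also have "\<dots> = lam * (\<nu> * real (Suc n) * pQ (Suc n))" by simp
    also have "\<dots> \<le> lam * (lam * pQ n)"
      using pQ_step[of n] lam by (intro mult_left_mono) auto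
    also have "\<dots> \<le> lam * (lam * 1)"
      using pQ_bounds(2)[of n] lam by (intro mult_left_mono) auto
    finally show ?thesis by simp
  qed
  note bound = this
  have "\<not> ?e < 0"
  proof
    assume neg: "?e < 0"
    obtain n where n: "real n > lam * lam / (- ?e * \<nu>)" using reals_Archimedean2 by blast
    let ?n = "max n (fst y)"
    have "lam * lam / (- ?e * \<nu>) < real (Suc ?n)" using n by auto
    then have "lam * lam < - ?e * (\<nu> * real (Suc ?n))"
      using neg nu by (subst (asm) pos_divide_less_eq) (auto simp: mult_ac mult_neg_pos mult_pos_neg)
    moreover have "fst y \<le> Suc ?n" by simp
    ultimately show False using bound[of ?n] by linarith
  qed
  then show ?thesis using expectation_generator_indicator_nonpos[OF y] by linarith
qed

text \<open>
  Second moments are what is needed: the rates grow linearly in \<open>q\<close>, and so will the test functions.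
\<close>

lemma integrable_square: "integrable (measure_pmf \<pi>) (\<lambda>x. (1 + real (fst x))\<^sup>2)"
proof -
  have pQ: "pQ = pmf (map_pmf fst \<pi>)"
    unfolding pQ_def by (auto simp: pmf_map vimage_def intro!: ext arg_cong2[where f=measure])
  have "summable (\<lambda>n. pQ n * (1 + real n)\<^sup>2)"
  proof -
    \<comment> \<open>From \<open>n\<close> to \<open>n + 1\<close> the square grows at most by the factor \<open>4\<close>, so \<open>pQ\<close> has to fall by \<open>8\<close>.\<close>
    obtain N where N: "real N > 8 * lam / \<nu>" using reals_Archimedean2 by blast
    show ?thesis
    proof (rule summable_ratio_test[where c="1/2" and N=N])
      fix n assume n: "N \<le> n"
      have "real (Suc n) > 8 * lam / \<nu>" using N n by linarith
      then have 1: "8 * lam \<le> \<nu> * real (Suc n)" using nu by (simp add: divide_simps mult_ac)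
      have 2: "(1 + real (Suc n))\<^sup>2 \<le> 4 * (1 + real n)\<^sup>2"
        by (simp add: power2_eq_square algebra_simps)
      have "8 * lam * (pQ (Suc n) * (1 + real (Suc n))\<^sup>2) \<le> (\<nu> * real (Suc n)) * (pQ (Suc n) * (4 * (1 + real n)\<^sup>2))"
        using nu by (intro mult_mono[OF 1] mult_left_mono[OF 2]) (auto simp: pQ_bounds)
      also have "\<dots> = (\<nu> * real (Suc n) * pQ (Suc n)) * (4 * (1 + real n)\<^sup>2)" by simp
      also have "\<dots> \<le> (lam * pQ n) * (4 * (1 + real n)\<^sup>2)"
        by (intro mult_right_mono pQ_step) auto
      finally have "2 * (pQ (Suc n) * (1 + real (Suc n))\<^sup>2) \<le> pQ n * (1 + real n)\<^sup>2"
        using lam by (simp add: mult_ac)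
      then show "norm (pQ (Suc n) * (1 + real (Suc n))\<^sup>2) \<le> 1/2 * norm (pQ n * (1 + real n)\<^sup>2)"
        using pQ_bounds by (simp add: abs_mult)
    qed auto
  qed
  then have "integrable (measure_pmf (map_pmf fst \<pi>)) (\<lambda>n. (1 + real n)\<^sup>2)"
    unfolding measure_pmf_eq_density
    by (subst integrable_density) (auto simp: integrable_count_space_nat_iff pQ abs_mult)
  then show ?thesis by (simp add: integrable_map_pmf_eq)
qed

lemma integrable_linear_growth:
  fixes f :: "nat \<times> nat \<Rightarrow> real"
  assumes "\<And>x. x \<in> S \<Longrightarrow> \<bar>f x\<bar> \<le> c * (1 + real (fst x))"
  shows "integrable (measure_pmf \<pi>) f"
proof (rule Bochner_Integration.integrable_bound)
  show "integrable (measure_pmf \<pi>) (\<lambda>x. \<bar>c\<bar> * (1 + real (fst x))\<^sup>2)"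
    by (intro integrable_mult_right integrable_square)
  show "AE x in measure_pmf \<pi>. norm (f x) \<le> norm (\<bar>c\<bar> * (1 + real (fst x))\<^sup>2)"
  proof (rule AE_pmfI)
    fix x assume "x \<in> set_pmf \<pi>"
    then have "\<bar>f x\<bar> \<le> c * (1 + real (fst x))" using assms support by blast
    also have "\<dots> \<le> \<bar>c\<bar> * (1 + real (fst x))\<^sup>2"
      by (intro mult_mono) (auto simp: power2_eq_square algebra_simps)
    finally show "norm (f x) \<le> norm (\<bar>c\<bar> * (1 + real (fst x))\<^sup>2)" by (simp add: abs_mult)
  qed
qed simp

lemma generator_growth:
  assumes f: "\<And>x. x \<in> S \<Longrightarrow> \<bar>f x\<bar> \<le> c * (1 + real (fst x))" and x: "x \<in> S"
  shows "\<bar>G f x\<bar> \<le> c * (3 * lam + 2 * \<mu> * M + 2 * \<nu>) * (1 + real (fst x))\<^sup>2"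
proof -
  obtain q z where xq: "x = (q, z)" by (cases x)
  define g where "g y = (if y \<in> S then f y else 0)" for y
  define a where "a = 1 + real q"
  have a: "a \<ge> 1" unfolding a_def by simp
  have c: "c \<ge> 0" using f[OF x] abs_ge_zero[of "f x"]
    by (smt (verit) mult_neg_pos of_nat_0_le_iff)
  have gb: "\<bar>g y\<bar> \<le> c * b" if "1 + real (fst y) \<le> b" for y b
  proof -
    have "\<bar>g y\<bar> \<le> c * (1 + real (fst y))" using f c unfolding g_def by auto
    also have "\<dots> \<le> c * b" using that c by (intro mult_left_mono)
    finally show ?thesis .
  qed
  have z: "real z \<le> real q" using x unfolding xq charging_states_def by auto
  have d: "\<bar>r * (g y - g w)\<bar> \<le> r * (c * b + c * b')"
    if "r \<ge> 0" "1 + real (fst y) \<le> b" "1 + real (fst w) \<le> b'" for r b b' y w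
    using gb[OF that(2)] gb[OF that(3)] that(1)
    by (auto simp: abs_mult intro!: mult_left_mono)
  have "\<bar>lam * (g (Suc q, Suc z) - g (q, z))\<bar> \<le> lam * (c * (a + 1) + c * a)"
    using lam by (intro d) (auto simp: a_def)
  moreover have "0 \<le> lam * (c * (a + 1) + c * a)" using lam c a by simp
  moreover have "\<bar>\<mu> * min (real z) M * (g (q, z - 1) - g (q, z))\<bar> \<le> \<mu> * min (real z) M * (c * a + c * a)"
    using mu M by (intro d) (auto simp: a_def)
  moreover have "\<bar>\<nu> * real z * (g (q - 1, z - 1) - g (q, z))\<bar> \<le> \<nu> * real z * (c * a + c * a)"
    using nu by (intro d) (auto simp: a_def)
  moreover have "\<bar>\<nu> * (real q - real z) * (g (q - 1, z) - g (q, z))\<bar> \<le> \<nu> * (real q - real z) * (c * a + c * a)"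
    using nu z by (intro d) (auto simp: a_def)
  ultimately have "\<bar>G g x\<bar> \<le> lam * (c * (a + 1) + c * a) + \<mu> * min (real z) M * (c * a + c * a)
      + \<nu> * real z * (c * a + c * a) + \<nu> * (real q - real z) * (c * a + c * a)"
    unfolding xq charging_generator.simps by (smt (verit))
  also have "\<dots> = c * (lam * (2 * a + 1) + \<mu> * min (real z) M * (2 * a) + \<nu> * real q * (2 * a))"
    by (simp add: algebra_simps)
  also have "\<dots> \<le> c * (lam * (3 * a\<^sup>2) + \<mu> * M * (2 * a\<^sup>2) + \<nu> * a * (2 * a))"
  proof -
    have aa: "a \<le> a\<^sup>2" using a by (simp add: power2_eq_square)
    show ?thesis using lam mu nu M a c aa
      by (intro mult_left_mono add_mono mult_mono) (auto simp: a_def)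
  qed
  also have "\<dots> = c * (3 * lam + 2 * \<mu> * M + 2 * \<nu>) * (1 + real (fst x))\<^sup>2"
    unfolding xq a_def by (simp add: power2_eq_square algebra_simps)
  finally show ?thesis using generator_cong[OF x, of f g] unfolding g_def by simp
qed

text \<open>
  Truncating \<open>f\<close> outside \<open>lower N\<close> leaves a finite combination of indicators, whose generators
  have mean zero; dominated convergence removes the truncation.
\<close>

lemma expectation_generator:
  assumes f: "\<And>x. x \<in> S \<Longrightarrow> \<bar>f x\<bar> \<le> c * (1 + real (fst x))"
  shows "E (G f) = 0"
proof -
  define s where "s N = G (\<lambda>x. if x \<in> lower N then f x else 0)" for N
  have "(\<lambda>N. E (s N)) \<longlonglongrightarrow> E (G f)"
  proof (rule integral_dominated_convergence)
    show "integrable (measure_pmf \<pi>)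
      (\<lambda>x. \<bar>c\<bar> * (3 * lam + 2 * \<mu> * M + 2 * \<nu>) * (1 + real (fst x))\<^sup>2)"
      by (intro integrable_mult_right integrable_square)
    show "AE x in measure_pmf \<pi>. (\<lambda>N. s N x) \<longlonglongrightarrow> G f x"
    proof (rule AE_pmfI)
      fix x assume "x \<in> set_pmf \<pi>"
      then have x: "x \<in> S" by (rule support)
      obtain q z where xq: "x = (q, z)" by (cases x)
      have "s N x = G f x" if N: "N \<ge> Suc q" for N
      proof -
        let ?g = "\<lambda>x. if x \<in> lower N then f x else 0"
        have "rate (q, z) y * (?g y - ?g (q, z)) = rate (q, z) y * (f y - f (q, z))"
          if "y \<in> {..Suc q} \<times> {..Suc z}" for y
        proof (cases "y \<in> S")
          case True
          then have "y \<in> lower N" "(q, z) \<in> lower N" using that N x xq by (auto simp: lower_def)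
          then show ?thesis by simp
        next
          case False
          then show ?thesis using rate_eq_0_outside[of q z y] x xq by simp
        qed
        then show ?thesis
          using x unfolding s_def xq by (subst (1 2) charging_generator_eq_sum) (auto intro: sum.cong)
      qed
      then show "(\<lambda>N. s N x) \<longlonglongrightarrow> G f x"
        by (intro tendsto_eventually eventually_sequentiallyI)
    qed
    show "AE x in measure_pmf \<pi>. norm (s N x) \<le> \<bar>c\<bar> * (3 * lam + 2 * \<mu> * M + 2 * \<nu>) * (1 + real (fst x))\<^sup>2" for N
    proof (rule AE_pmfI)
      fix x assume "x \<in> set_pmf \<pi>"
      then have x: "x \<in> S" by (rule support)
      have "\<bar>if y \<in> lower N then f y else 0\<bar> \<le> \<bar>c\<bar> * (1 + real (fst y))" if "y \<in> S" for y
        using f[OF that] by (auto intro: order_trans mult_right_mono)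
      then show "norm (s N x) \<le> \<bar>c\<bar> * (3 * lam + 2 * \<mu> * M + 2 * \<nu>) * (1 + real (fst x))\<^sup>2"
        unfolding s_def real_norm_def by (rule generator_growth[OF _ x])
    qed
  qed auto
  moreover have "E (s N) = 0" for N
    unfolding s_def expectation_generator_truncated
    by (intro sum.neutral) (auto simp: expectation_generator_indicator lower_def)
  ultimately show ?thesis by (simp add: LIMSEQ_const_iff)
qed

section \<open>Flow identities\<close>

lemma flow_balance:
  assumes f: "\<And>x. x \<in> S \<Longrightarrow> \<bar>f x\<bar> \<le> c * (1 + real (fst x))"
    and G: "\<And>q z. (q, z) \<in> S \<Longrightarrow> G f (q, z) = a (q, z) - b (q, z)"
    and int: "integrable (measure_pmf \<pi>) a" "integrable (measure_pmf \<pi>) b"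
  shows "E a = E b"
proof -
  have "E (G f) = E (\<lambda>x. a x - b x)"
  proof (rule integral_cong_AE)
    have "G f x = a x - b x" if "x \<in> S" for x using G that by (cases x) blast
    then show "AE x in measure_pmf \<pi>. G f x = a x - b x" by (intro AE_pmfI) (simp add: support)
  qed auto
  then show ?thesis using expectation_generator[OF f] int by simp
qed

definition open_states :: "(nat \<times> nat) set" where
  "open_states = {x. enat (fst x) < K}"

lemma integrable_indicator: "integrable (measure_pmf \<pi>) (\<lambda>x. indicator A x :: real)"
  by (rule measure_pmf.integrable_const_bound[where B=1]) auto

lemma mean_Q_flow: "\<nu> * mean_Q \<pi> = lam * measure_pmf.prob \<pi> open_states"
proof -
  have "E (\<lambda>x. lam * indicator open_states x) = E (\<lambda>x. \<nu> * real (fst x))"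
  proof (rule flow_balance[where c=1 and f="\<lambda>x. real (fst x)"])
    fix q z assume x: "(q, z) \<in> S"
    show "G (\<lambda>x. real (fst x)) (q, z) = lam * indicator open_states (q, z) - \<nu> * real (fst (q, z))"
    proof (cases q)
      case 0
      then show ?thesis using x by (auto simp: open_states_def charging_states_def)
    qed (auto simp: open_states_def algebra_simps)
  next
    show "integrable (measure_pmf \<pi>) (\<lambda>x. \<nu> * real (fst x))"
      by (rule integrable_linear_growth[where c=\<nu>]) (use nu in auto)
  qed (auto intro!: integrable_mult_right integrable_indicator)
  then show ?thesis unfolding mean_Q_def by (simp add: case_prod_unfold)
qed

definition mean_Z :: real where
  "mean_Z = E (\<lambda>x. real (snd x))"

lemma integrable_fst: "integrable (measure_pmf \<pi>) (\<lambda>x. real (fst x))"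
  by (rule integrable_linear_growth[where c=1]) auto

lemma integrable_snd: "integrable (measure_pmf \<pi>) (\<lambda>x. real (snd x))"
  by (rule integrable_linear_growth[where c=1]) (auto simp: charging_states_def)

lemma mean_C_eq: "mean_C \<pi> = mean_Q \<pi> - mean_Z"
  unfolding mean_C_def mean_Q_def mean_Z_def case_prod_unfold
  using integrable_fst integrable_snd by (rule Bochner_Integration.integral_diff)

lemma mean_C_flow: "\<nu> * mean_C \<pi> = \<mu> * E (\<lambda>x. min (real (snd x)) M)"
proof -
  have "E (\<lambda>x. \<mu> * min (real (snd x)) M) = E (\<lambda>x. \<nu> * (real (fst x) - real (snd x)))"
  proof (rule flow_balance[where c=1 and f="\<lambda>x. real (fst x) - real (snd x)"])
    fix q z assume x: "(q, z) \<in> S"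
    have "z \<le> q" using x by (auto simp: charging_states_def)
    then show "G (\<lambda>x. real (fst x) - real (snd x)) (q, z) =
        \<mu> * min (real (snd (q, z))) M - \<nu> * (real (fst (q, z)) - real (snd (q, z)))"
      using M by (cases q; cases z) (auto simp: algebra_simps)
  next
    have "\<bar>\<mu> * min (real z) M\<bar> \<le> \<mu> * M" for z :: nat
      using mu M by (simp add: abs_mult)
    then show "integrable (measure_pmf \<pi>) (\<lambda>x. \<mu> * min (real (snd x)) M)"
      by (intro measure_pmf.integrable_const_bound[where B="\<mu> * M"]) auto
    show "integrable (measure_pmf \<pi>) (\<lambda>x. \<nu> * (real (fst x) - real (snd x)))"
      using integrable_fst integrable_snd by simp
  qed (auto simp: charging_states_def)
  then show ?thesis unfolding mean_C_def by (simp add: case_prod_unfold)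
qed

lemma pQ_flow: "\<nu> * real (Suc n) * pQ (Suc n) = (if enat n < K then lam else 0) * pQ n"
proof -
  have "(\<Sum>y\<in>lower n. E (G (indicator {y}))) = 0"
    by (intro sum.neutral) (auto simp: expectation_generator_indicator lower_def)
  then show ?thesis unfolding level_flow by simp
qed

definition departure_rate :: "nat \<Rightarrow> real" where
  "departure_rate z = \<mu> * min (real z) M + \<nu> * real z"

text \<open>
  Under first come first served, the mean time a vehicle stays uncharged if it finds \<open>z\<close> uncharged
  vehicles on arrival.  The \<open>z + 1\<close> vehicles then uncharged accumulate uncharged time at rate \<open>z + 1\<close>
  until the first of them is charged or departs, at rate \<open>departure_rate (z + 1)\<close>; after that they
  are \<open>z\<close>, as if the new vehicle had not come.  The quotient is thus what the new vehicle adds to the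
  total uncharged time, and all of it is its own, since it delays none of its predecessors.
\<close>

definition mean_wait :: "nat \<Rightarrow> real" where
  "mean_wait z = real (Suc z) / departure_rate (Suc z)"

lemma departure_rate_pos: "departure_rate (Suc z) > 0"
  unfolding departure_rate_def using mu nu M by (intro add_nonneg_pos) auto

lemma mean_wait_bounds: "0 \<le> mean_wait z" "mean_wait z \<le> 1 / \<nu>"
proof -
  show "0 \<le> mean_wait z" unfolding mean_wait_def using departure_rate_pos[of z] by simp
  have "\<nu> * real (Suc z) \<le> departure_rate (Suc z)" using mu M by (simp add: departure_rate_def)
  then show "mean_wait z \<le> 1 / \<nu>"
    unfolding mean_wait_def using nu departure_rate_pos[of z] by (simp add: field_simps)
qed

lemma mono_mean_wait: "mono mean_wait"
proof (rule incseq_SucI)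
  fix z
  have "real (Suc z) * min (real (Suc (Suc z))) M \<le> real (Suc (Suc z)) * min (real (Suc z)) M"
    using min_ratio_decreasing[of M "Suc z"] M by simp
  then have "real (Suc z) * departure_rate (Suc (Suc z)) \<le> real (Suc (Suc z)) * departure_rate (Suc z)"
    using mult_left_mono[of _ _ \<mu>] mu unfolding departure_rate_def
    by (simp only: distrib_left mult.left_commute[of _ \<mu>] mult.left_commute[of _ \<nu>] mult.commute[of "real (Suc (Suc z))" "real (Suc z)"])
       simp
  then show "mean_wait z \<le> mean_wait (Suc z)"
    unfolding mean_wait_def using departure_rate_pos by (simp add: divide_simps mult.commute)
qed

text \<open>
  Arrivals move \<open>Z\<close> up by one and nothing else increases it, so test functions of \<open>Z\<close> alone give a
  balance between arrivals and the decrease of \<open>Z\<close>.  The weight \<open>w j\<close> is attached to the step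
  between \<open>j\<close> and \<open>j + 1\<close>.
\<close>

lemma snd_flow:
  assumes w: "\<And>z. \<bar>w z\<bar> \<le> b"
    and int: "integrable (measure_pmf \<pi>) (\<lambda>x. departure_rate (snd x) * w (snd x - 1))"
  shows "lam * E (\<lambda>x. indicator open_states x * w (snd x)) =
    E (\<lambda>x. departure_rate (snd x) * w (snd x - 1))"
proof -
  have "E (\<lambda>x. lam * (indicator open_states x * w (snd x))) =
    E (\<lambda>x. departure_rate (snd x) * w (snd x - 1))"
  proof (rule flow_balance[where c=b and f="\<lambda>x. \<Sum>i<snd x. w i"])
    fix x assume x: "x \<in> S"
    have "\<bar>\<Sum>i<snd x. w i\<bar> \<le> (\<Sum>i<snd x. b)"
      by (rule order_trans[OF sum_abs]) (intro sum_mono w)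
    also have "\<dots> \<le> b * (1 + real (fst x))"
      using x order_trans[OF abs_ge_zero w]
      by (cases x) (auto simp: charging_states_def mult.commute intro!: mult_left_mono)
    finally show "\<bar>\<Sum>i<snd x. w i\<bar> \<le> b * (1 + real (fst x))" .
  next
    fix q z assume x: "(q, z) \<in> S"
    show "G (\<lambda>x. \<Sum>i<snd x. w i) (q, z) = lam * (indicator open_states (q, z) * w (snd (q, z)))
       - departure_rate (snd (q, z)) * w (snd (q, z) - 1)"
      using M by (cases z) (auto simp: open_states_def departure_rate_def algebra_simps)
  next
    show "integrable (measure_pmf \<pi>) (\<lambda>x. lam * (indicator open_states x * w (snd x)))"
      using w order_trans[OF abs_ge_zero w]
      by (intro integrable_mult_right measure_pmf.integrable_const_bound[where B=b])
         (auto simp: indicator_def)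
  qed (rule int)
  then show ?thesis by simp
qed

text \<open>
  Little's law for the uncharged vehicles.
\<close>

lemma mean_Z_flow: "mean_Z = lam * E (\<lambda>x. indicator open_states x * mean_wait (snd x))"
proof -
  have eq: "departure_rate z * mean_wait (z - 1) = real z" for z
    using departure_rate_pos[of "z - 1"] M
    by (cases z) (auto simp: mean_wait_def departure_rate_def)
  have "\<bar>mean_wait z\<bar> \<le> 1 / \<nu>" for z using mean_wait_bounds[of z] by simp
  from snd_flow[of mean_wait, OF this] show ?thesis
    unfolding mean_Z_def eq using integrable_snd by simp
qed

lemma cut_flow:
  "lam * measure_pmf.prob \<pi> (open_states \<inter> {x. snd x = j}) =
     departure_rate (Suc j) * measure_pmf.prob \<pi> {x. snd x = Suc j}"
proof -
  have eq: "departure_rate (snd x) * indicator {j} (snd x - 1) =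
      departure_rate (Suc j) * indicator {x. snd x = Suc j} x" for x :: "nat \<times> nat"
    using M by (cases "snd x") (auto simp: indicator_def departure_rate_def)
  have "(\<lambda>x. indicator open_states x * indicator {j} (snd x) :: real) =
      indicator (open_states \<inter> {x. snd x = j})"
    by (auto simp: indicator_def)
  moreover have "lam * E (\<lambda>x. indicator open_states x * indicator {j} (snd x)) =
    E (\<lambda>x. departure_rate (Suc j) * indicator {x. snd x = Suc j} x)"
    unfolding eq[symmetric]
    by (rule snd_flow[where b=1], simp add: indicator_def, unfold eq)
       (intro integrable_mult_right integrable_indicator)
  ultimately show ?thesis by simp
qed

end

section \<open>Lots with finitely many spaces\<close>

locale finite_charging_station = charging_station lam \<mu> \<nu> "enat N" M \<pi>
  for lam \<mu> \<nu> :: real and N :: nat and M :: real and \<pi> :: "(nat \<times> nat) pmf" +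
  assumes N: "N > 0"
begin

lemma mem_S_iff: "(q, z) \<in> S \<longleftrightarrow> z \<le> q \<and> q \<le> N"
  by (auto simp: charging_states_def)

lemma finite_S: "finite S"
  by (rule finite_subset[of _ "{..N} \<times> {..N}"]) (auto simp: charging_states_def)

lemma integrable_any: "integrable (measure_pmf \<pi>) (f :: nat \<times> nat \<Rightarrow> real)"
  by (rule finite_support_integrable[OF finite_S])

lemma expectation_generator_finite: "E (G f) = 0"
proof (rule expectation_generator)
  fix x assume x: "x \<in> S"
  have "\<bar>f x\<bar> \<le> (\<Sum>y\<in>S. \<bar>f y\<bar>) * 1"
    using member_le_sum[OF x _ finite_S, of "\<lambda>y. \<bar>f y\<bar>"] by simp
  also have "\<dots> \<le> (\<Sum>y\<in>S. \<bar>f y\<bar>) * (1 + real (fst x))"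
    by (intro mult_left_mono sum_nonneg) auto
  finally show "\<bar>f x\<bar> \<le> (\<Sum>y\<in>S. \<bar>f y\<bar>) * (1 + real (fst x))" .
qed

lemma expectation_mono:
  assumes "\<And>q z. z \<le> q \<Longrightarrow> q \<le> N \<Longrightarrow> f (q, z) \<le> g (q, z)"
  shows "E f \<le> (E g :: real)"
proof (rule integral_mono_AE)
  have "f x \<le> g x" if "x \<in> S" for x
    using assms that by (cases x) (auto simp: mem_S_iff)
  then show "AE x in measure_pmf \<pi>. f x \<le> g x" by (intro AE_pmfI) (simp add: support)
qed (rule integrable_any)+

lemma prob_open_pos: "measure_pmf.prob \<pi> open_states > 0"
proof -
  have "E (\<lambda>x. real N * (1 - indicator open_states x)) \<le> E (\<lambda>x. real (fst x))"
    by (rule expectation_mono) (auto simp: open_states_def indicator_def)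
  then have "real N * (1 - measure_pmf.prob \<pi> open_states) \<le> mean_Q \<pi>"
    unfolding mean_Q_def case_prod_unfold using integrable_any by simp
  then show ?thesis
    using mean_Q_flow nu N measure_nonneg[of "measure_pmf \<pi>" open_states]
    by (cases "measure_pmf.prob \<pi> open_states = 0") (auto simp: zero_less_measure_iff)
qed

lemma expectation_open:
  "E (\<lambda>x. indicator open_states x * f (snd x)) =
     (\<Sum>j<N. f j * measure_pmf.prob \<pi> (open_states \<inter> {x. snd x = j}))"
proof -
  have "E (\<lambda>x. indicator open_states x * f (snd x)) =
      E (\<lambda>x. \<Sum>j<N. f j * indicator (open_states \<inter> {x. snd x = j}) x)"
  proof (rule integral_cong_AE)
    have "indicator open_states x * f (snd x) =
      (\<Sum>j<N. f j * indicator (open_states \<inter> {x. snd x = j}) x)" if x: "x \<in> S" for x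
    proof (cases "x \<in> open_states")
      case True
      then have "snd x < N" using x by (cases x) (auto simp: open_states_def mem_S_iff)
      have "(\<Sum>j<N. f j * indicator (open_states \<inter> {x. snd x = j}) x) =
        (\<Sum>j<N. if j = snd x then f j else 0)"
        using True by (intro sum.cong) (auto simp: indicator_def)
      then show ?thesis using True \<open>snd x < N\<close> by simp
    qed simp
    then show "AE x in measure_pmf \<pi>. indicator open_states x * f (snd x) =
      (\<Sum>j<N. f j * indicator (open_states \<inter> {x. snd x = j}) x)"
      by (intro AE_pmfI) (simp add: support)
  qed auto
  also have "\<dots> = (\<Sum>j<N. f j * measure_pmf.prob \<pi> (open_states \<inter> {x. snd x = j}))"
    by (subst Bochner_Integration.integral_sum) (auto intro: integrable_any)
  finally show ?thesis .
qed

lemma prob_open_high: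
  assumes "j \<ge> N"
  shows "measure_pmf.prob \<pi> (open_states \<inter> {x. snd x = j}) = 0"
proof -
  have "x \<notin> open_states \<inter> {x. snd x = j}" if "x \<in> S" for x
    using assms that by (cases x) (auto simp: open_states_def mem_S_iff)
  then show ?thesis by (subst measure_pmf_zero_iff) (auto dest: support)
qed

section \<open>What arrivals see and what departures leave behind\<close>

text \<open>
  \<open>V (q, z)\<close> is the expected integral of \<open>exp(- \<nu> t) u(Z\<^sub>t)\<close> from the state \<open>(q, z)\<close> until the lot
  becomes full; hence the value \<open>0\<close> at \<open>q = N\<close>.  It increases with \<open>z\<close> because exchanging a
  charged vehicle for an uncharged one slows the charging of the others and leaves the number of
  vehicles unaffected.
\<close>

lemma killed_value_function:
  assumes u: "\<And>z. 0 \<le> u z" "\<And>z. u z \<le> b" "\<And>z. Suc z < N \<Longrightarrow> u z \<le> u (Suc z)"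
  obtains V where
    "\<And>z. V (N, z) = 0"
    "\<And>q z. z \<le> q \<Longrightarrow> q < N \<Longrightarrow> \<nu> * V (q, z) = u z + G V (q, z)"
    "\<And>q z. z < q \<Longrightarrow> q < N \<Longrightarrow> V (q, z) \<le> V (q, Suc z)"
proof -
  \<comment> \<open>Uniformization: as \<open>q \<le> N - 1\<close> before the lot is full, \<open>c - \<nu>\<close> bounds the total rate out of
    \<open>(q, z)\<close>, and \<open>\<nu>\<close> is the discount rate.  The missing rate is spent on staying put.\<close>
  define c where "c = lam + \<mu> * M + \<nu> * real N"
  have c: "c > 0" unfolding c_def using lam mu nu M by (intro add_pos_nonneg) auto
  define num where "num V q z = u z + lam * V (Suc q, Suc z)
      + \<mu> * min (real z) M * V (q, z - 1) + \<mu> * (M - min (real z) M) * V (q, z)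
      + \<nu> * real z * V (q - 1, z - 1) + \<nu> * (real q - real z) * V (q - 1, z)
      + \<nu> * (real N - 1 - real q) * V (q, z)" for V q z
  define T where "T V = (\<lambda>(q, z). if z \<le> q \<and> q < N then num V q z / c else 0)" for V
  define increasing where "increasing V \<longleftrightarrow> (\<forall>q z. q \<ge> N \<longrightarrow> V (q, z) = 0) \<and>
      (\<forall>q z. z < q \<and> q < N \<longrightarrow> V (q, z) \<le> V (q, Suc z))" for V :: "nat \<times> nat \<Rightarrow> real"
  have b: "0 \<le> b" using u(1,2) order_trans by blast
  have num_mono: "num V q z \<le> num W q z" if "\<And>x. V x \<le> W x" "z \<le> q" "q < N" for V W q z
    unfolding num_def using that lam mu nu M
    by (intro add_mono mult_left_mono order_refl) auto
  have "\<exists>V. T V = V \<and> (\<forall>x. 0 \<le> V x) \<and> (\<forall>x. V x \<le> b / \<nu>) \<and> increasing V"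
  proof (rule monotone_fixed_point)
    fix V W :: "nat \<times> nat \<Rightarrow> real" and x assume "\<And>x. V x \<le> W x"
    then show "T V x \<le> T W x"
      unfolding T_def using num_mono c by (auto simp: divide_right_mono split: prod.split)
  next
    fix X :: "nat \<Rightarrow> nat \<times> nat \<Rightarrow> real" and V and x :: "nat \<times> nat"
    assume X: "\<And>x. (\<lambda>n. X n x) \<longlonglongrightarrow> V x"
    obtain q z where x: "x = (q, z)" by (cases x)
    show "(\<lambda>n. T (X n) x) \<longlonglongrightarrow> T V x"
    proof (cases "z \<le> q \<and> q < N")
      case True
      have "(\<lambda>n. num (X n) q z / c) \<longlonglongrightarrow> num V q z / c"
        unfolding num_def by (intro tendsto_intros X) (use c in auto)
      then show ?thesis using True unfolding T_def x by simp
    next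
      case False
      then have "T Y (q, z) = 0" for Y by (auto simp: T_def)
      then show ?thesis unfolding x by simp
    qed
  next
    show "0 \<le> T (\<lambda>_. 0) x" for x
      unfolding T_def num_def using u c by (auto split: prod.split)
    show "T (\<lambda>_. b / \<nu>) x \<le> b / \<nu>" for x
    proof -
      obtain q z where x: "x = (q, z)" by (cases x)
      have "num (\<lambda>_. b / \<nu>) q z = u z + (c - \<nu>) * (b / \<nu>)"
        unfolding num_def c_def by (simp add: algebra_simps)
      also have "\<dots> \<le> b + (c - \<nu>) * (b / \<nu>)" using u by simp
      also have "\<dots> = (b / \<nu>) * c" using nu by (simp add: field_simps)
      finally show ?thesis unfolding T_def x using c b nu by (simp add: pos_divide_le_eq)
    qed
    show "0 \<le> b / \<nu>" using b nu by simp
    show "increasing (\<lambda>_. 0)" by (simp add: increasing_def)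
    show "increasing (T V)" if V: "increasing V" "\<And>x. 0 \<le> V x" for V
      unfolding increasing_def
    proof (intro conjI allI impI)
      fix q z assume qz: "z < q \<and> q < N"
      have nonneg: "0 \<le> r * (V (a, Suc y) - V (a, y))" if "r \<ge> 0" "y < a" "a \<le> N" for a y r
        using V that by (cases "a = N") (auto simp: increasing_def)
      have mid: "0 \<le> r * real z * (V (a, z) - V (a, z - 1))" if "z \<le> a" "a \<le> N" "r \<ge> 0" for r a
        using that nonneg[of "r * real z" "z - 1" a] by (cases z) auto
      have low: "0 \<le> \<mu> * min (real z) M * (V (q, z) - V (q, z - 1))"
        using qz nonneg[of "\<mu> * min (real z) M" "z - 1" q] mu M by (cases z) auto
      have far: "0 \<le> \<nu> * (real q - real (Suc z)) * (V (q - 1, Suc z) - V (q - 1, z))"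
        using qz nonneg[of "\<nu> * (real q - real (Suc z))" z "q - 1"] nu by (cases "q = Suc z") auto
      have "num V q (Suc z) - num V q z = (u (Suc z) - u z)
         + lam * (V (Suc q, Suc (Suc z)) - V (Suc q, Suc z))
         + \<mu> * min (real z) M * (V (q, z) - V (q, z - 1))
         + \<mu> * (M - min (real (Suc z)) M) * (V (q, Suc z) - V (q, z))
         + \<nu> * real z * (V (q - 1, z) - V (q - 1, z - 1))
         + \<nu> * (real q - real (Suc z)) * (V (q - 1, Suc z) - V (q - 1, z))
         + \<nu> * (real N - 1 - real q) * (V (q, Suc z) - V (q, z))"
        unfolding num_def by (simp add: algebra_simps)
      also have "\<dots> \<ge> 0"
        using qz u(3)[of z] lam mu nu M
        by (intro add_nonneg_nonneg nonneg mid low far) auto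
      finally have "num V q z \<le> num V q (Suc z)" by simp
      then show "T V (q, z) \<le> T V (q, Suc z)"
        unfolding T_def using qz c by (auto intro: divide_right_mono)
    qed (simp add: T_def)
    show "increasing V" if X: "\<And>n. increasing (X n)" "\<And>x. (\<lambda>n. X n x) \<longlonglongrightarrow> V x" for X V
      unfolding increasing_def
    proof (intro conjI allI impI)
      fix q z assume "N \<le> q"
      then have "(\<lambda>n. X n (q, z)) = (\<lambda>_. 0)" using X(1) by (auto simp: increasing_def)
      then show "V (q, z) = 0" using X(2)[of "(q, z)"] by (simp add: LIMSEQ_const_iff)
    next
      fix q z assume "z < q \<and> q < N"
      then show "V (q, z) \<le> V (q, Suc z)"
        by (intro LIMSEQ_le[OF X(2) X(2)]) (use X(1) in \<open>auto simp: increasing_def\<close>)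
    qed
  qed
  then obtain V where V: "T V = V" "increasing V" by blast
  show thesis
  proof (rule that)
    show "V (N, z) = 0" for z using V by (auto simp: increasing_def)
    show "V (q, z) \<le> V (q, Suc z)" if "z < q" "q < N" for q z
      using V that by (auto simp: increasing_def)
    show "\<nu> * V (q, z) = u z + G V (q, z)" if "z \<le> q" "q < N" for q z
    proof -
      have "V (q, z) = num V q z / c" using that fun_cong[OF V(1), of "(q, z)"] by (simp add: T_def)
      then have "c * V (q, z) = num V q z" using c by simp
      then show ?thesis using that unfolding num_def c_def by (simp add: algebra_simps)
    qed
  qed
qed

text \<open>
  \<open>W\<close> is \<open>\<nu>\<close> times the sum, over the vehicles present, of \<open>V\<close> at the state of the other vehicles,
  minus \<open>\<lambda> V\<close>.  An accepted arrival adds the summand of the new vehicle; together with \<open>- \<lambda> V\<close> this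
  leaves \<open>\<lambda> u\<close>.  The equation for \<open>V\<close>, with the departure of the tagged vehicle in the place of the
  discounting, turns each other summand into \<open>- \<nu> u\<close>, with two corrections.  First, if \<open>q = N\<close>, the
  \<open>N - 1\<close> others see no arrival, whereas \<open>V\<close> is killed by one at rate \<open>\<lambda>\<close>; this is made up by
  \<open>- \<lambda> V\<close>, which vanishes while the lot is full and is regained when a vehicle departs.  Second, the
  tagged vehicle, when uncharged, takes part of the power.  Summed over the uncharged vehicles, the
  others are charged at the rate \<open>\<mu> (z - 1) min(z,M)\<close> instead of \<open>\<mu> z min(z - 1,M)\<close>, which is at
  least as large, and \<open>V\<close> increases with \<open>z\<close>.
\<close>

lemma tagged_generator_bound:
  assumes V0: "\<And>z. V (N, z) = 0"
    and V: "\<And>q z. z \<le> q \<Longrightarrow> q < N \<Longrightarrow> \<nu> * V (q, z) = u z + G V (q, z)"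
    and V_mono: "\<And>q z. z < q \<Longrightarrow> q < N \<Longrightarrow> V (q, z) \<le> V (q, Suc z)"
    and W: "W = (\<lambda>(q, z). \<nu> * (real z * V (q - 1, z - 1) + (real q - real z) * V (q - 1, z))
      - lam * V (q, z))"
    and qz: "z \<le> q" "q \<le> N"
  shows "G W (q, z) \<ge> lam * indicator open_states (q, z) * u z
    - \<nu> * (real z * u (z - 1) + (real q - real z) * u z)"
proof -
  \<comment> \<open>The residual of the equation for \<open>V\<close>: with it, the expansions of \<open>G W\<close> below are polynomial identities.\<close>
  define R where "R a b = \<nu> * V (a, b) - u b - G V (a, b)" for a b
  have R: "R a b = 0" if "b \<le> a" "a < N" for a b using V[OF that] by (simp add: R_def)
  have ind: "indicator open_states (q, z) = (if q < N then 1 else (0::real))"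
    by (simp add: open_states_def)
  consider "q = 0" "z = 0" | p where "q = Suc p" "z = 0" | p y where "q = Suc p" "z = Suc y"
    using qz by (cases q; cases z) auto
  then show ?thesis
  proof cases
    case 1
    have eq: "G W (q, z) = lam * indicator open_states (q, z) * u z + lam * R 0 0"
      unfolding 1 W R_def ind[unfolded 1] using N M by (simp add: algebra_simps)
    show ?thesis unfolding eq using R[of 0 0] N 1 by simp
  next
    case (2 p)
    have "G W (q, z) = lam * indicator open_states (q, z) * u z - \<nu> * real q * u z
      - \<nu> * real q * R p 0 + (if q < N then lam * R q 0 else 0)"
    proof (cases "q < N")
      case True
      then show ?thesis unfolding 2 W R_def ind[unfolded 2] using M by (simp add: algebra_simps)
    next
      case False
      then have "N = Suc p" using 2 qz by simp
      then show ?thesis unfolding 2 W R_def ind[unfolded 2] using M V0 by (simp add: algebra_simps)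
    qed
    then show ?thesis using R[of 0 p] R[of 0 q] qz 2 by simp
  next
    case (3 p y)
    have eq: "G W (q, z) = lam * indicator open_states (q, z) * u z
      - \<nu> * (real z * u (z - 1) + (real q - real z) * u z)
      + \<nu> * \<mu> * (real (Suc y) * min (real y) M - real y * min (real (Suc y)) M) * (V (p, y) - V (p, y - 1))
      - \<nu> * real z * R p y - \<nu> * (real q - real z) * R p z + (if q < N then lam * R q z else 0)"
    proof (cases "q < N")
      case True
      then show ?thesis unfolding 3 W R_def ind[unfolded 3] by (simp add: algebra_simps)
    next
      case False
      then have "N = Suc p" using 3 qz by simp
      then show ?thesis unfolding 3 W R_def ind[unfolded 3] using V0 by (simp add: algebra_simps)
    qed
    have zero: "\<nu> * real z * R p y = 0" "\<nu> * (real q - real z) * R p z = 0"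
        "(if q < N then lam * R q z else 0) = 0"
      using R[of y p] R[of z p] R[of z q] qz 3 by (cases "z = q"; auto)+
    have "0 \<le> \<nu> * \<mu> * (real (Suc y) * min (real y) M - real y * min (real (Suc y)) M)
        * (V (p, y) - V (p, y - 1))"
    proof (intro mult_nonneg_nonneg)
      show "0 \<le> real (Suc y) * min (real y) M - real y * min (real (Suc y)) M"
        using min_ratio_decreasing[of M y] M by simp
      show "0 \<le> V (p, y) - V (p, y - 1)"
        using V_mono[of "y - 1" p] qz 3 by (cases y) auto
    qed (use mu nu in auto)
    then show ?thesis unfolding eq zero by linarith
  qed
qed

text \<open>
  The preceding bound says that departures leave behind at least the flow of \<open>u\<close> that arrivals
  find.  By \<open>snd_flow\<close> the latter equals the flow of \<open>u\<close> left behind by vehicles that become charged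
  or depart uncharged.  The uncharged departures occur on both sides and cancel.
\<close>

lemma charged_flow_bound:
  assumes u: "\<And>z. 0 \<le> u z" "\<And>z. u z \<le> b" "\<And>z. Suc z < N \<Longrightarrow> u z \<le> u (Suc z)"
  shows "E (\<lambda>x. \<mu> * min (real (snd x)) M * u (snd x - 1)) \<le>
    E (\<lambda>x. \<nu> * (real (fst x) - real (snd x)) * u (snd x))"
proof -
  obtain V where V: "\<And>z. V (N, z) = 0"
    "\<And>q z. z \<le> q \<Longrightarrow> q < N \<Longrightarrow> \<nu> * V (q, z) = u z + G V (q, z)"
    "\<And>q z. z < q \<Longrightarrow> q < N \<Longrightarrow> V (q, z) \<le> V (q, Suc z)"
    using killed_value_function[of u b] u by metis
  define W where "W = (\<lambda>(q, z). \<nu> * (real z * V (q - 1, z - 1) + (real q - real z) * V (q - 1, z))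
      - lam * V (q, z))"
  let ?arr = "\<lambda>x. indicator open_states x * u (snd x)"
  let ?unc = "\<lambda>x. \<nu> * real (snd x) * u (snd x - 1)"
  let ?chg = "\<lambda>x. \<nu> * (real (fst x) - real (snd x)) * u (snd x)"
  let ?pow = "\<lambda>x. \<mu> * min (real (snd x)) M * u (snd x - 1)"
  have "E (\<lambda>x. lam * ?arr x - (?unc x + ?chg x)) \<le> E (G W)"
    by (rule expectation_mono)
       (use tagged_generator_bound[OF V W_def] in \<open>simp add: algebra_simps\<close>)
  then have "lam * E ?arr \<le> E ?unc + E ?chg"
    unfolding expectation_generator_finite using integrable_any by simp
  moreover have "lam * E ?arr = E (\<lambda>x. departure_rate (snd x) * u (snd x - 1))"
    by (rule snd_flow[of u b, OF _ integrable_any]) (use u in simp)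
  moreover have "E (\<lambda>x. departure_rate (snd x) * u (snd x - 1)) = E ?pow + E ?unc"
    using integrable_any
    by (subst Bochner_Integration.integral_add[symmetric])
       (auto simp: departure_rate_def algebra_simps intro!: Bochner_Integration.integral_cong)
  ultimately show ?thesis by linarith
qed

section \<open>Comparison with the full parking lot\<close>

text \<open>
  The increments \<open>g z = h (z + 1) - h z\<close> of the solution \<open>h\<close> of the Poisson equation of the full lot.
  Subtracting the equations at \<open>z + 1\<close> and \<open>z\<close> eliminates \<open>e\<close> and turns \<open>g z\<close> into the mean lifetime
  of the gap between two coupled full lots that start from \<open>z\<close> and \<open>z + 1\<close>: it closes at the rate
  \<open>\<nu> + \<mu> (min(z + 1,M) - min(z,M))\<close>, which is at least \<open>\<nu>\<close> and, \<open>min(z,M)\<close> being concave,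
  decreases with \<open>z\<close>.  Hence \<open>g \<le> 1 / \<nu>\<close>, and \<open>g\<close> increases.
\<close>

lemma full_lot_slope:
  obtains g e where
    "\<And>z. 0 \<le> g z" "\<And>z. g z \<le> 1 / \<nu>" "\<And>z. Suc z < N \<Longrightarrow> g z \<le> g (Suc z)"
    "\<And>z. z \<le> N \<Longrightarrow> \<nu> * (real N - real z) * g z - \<mu> * min (real z) M * g (z - 1) = e - real z"
proof -
  define c where "c = \<mu> * M + \<nu> * real N"
  have c: "c > 0" unfolding c_def using mu nu M by (intro add_pos_nonneg) auto
  define num where "num g z = 1 + \<nu> * (real N - 1 - real z) * g (Suc z)
      + \<mu> * min (real z) M * g (z - 1)
      + (\<nu> * real z + \<mu> * (M - min (real (Suc z)) M)) * g z" for g z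
  define T where "T g z = (if z < N then num g z / c else 0)" for g z
  define increasing where "increasing g \<longleftrightarrow> (\<forall>z. Suc z < N \<longrightarrow> g z \<le> g (Suc z))"
    for g :: "nat \<Rightarrow> real"
  have num_mono: "num g z \<le> num h z" if "\<And>x. g x \<le> h x" "z < N" for g h z
    unfolding num_def using that mu nu M
    by (intro add_mono mult_left_mono order_refl) auto
  have "\<exists>g. T g = g \<and> (\<forall>x. 0 \<le> g x) \<and> (\<forall>x. g x \<le> 1 / \<nu>) \<and> increasing g"
  proof (rule monotone_fixed_point)
    fix g h :: "nat \<Rightarrow> real" and x assume "\<And>x. g x \<le> h x"
    then show "T g x \<le> T h x"
      unfolding T_def using num_mono c by (auto simp: divide_right_mono)
  next
    fix X :: "nat \<Rightarrow> nat \<Rightarrow> real" and g z assume X: "\<And>z. (\<lambda>n. X n z) \<longlonglongrightarrow> g z"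
    have "(\<lambda>n. num (X n) z / c) \<longlonglongrightarrow> num g z / c"
      unfolding num_def by (intro tendsto_intros X) (use c in auto)
    then show "(\<lambda>n. T (X n) z) \<longlonglongrightarrow> T g z" unfolding T_def by simp
  next
    show "0 \<le> T (\<lambda>_. 0) z" for z unfolding T_def num_def using c by simp
    show "T (\<lambda>_. 1 / \<nu>) z \<le> 1 / \<nu>" for z
    proof -
      have "num (\<lambda>_. 1 / \<nu>) z = 1 + (c - \<nu> - \<mu> * (min (real (Suc z)) M - min (real z) M)) * (1 / \<nu>)"
        unfolding num_def c_def by (simp add: algebra_simps)
      also have "\<dots> \<le> 1 + (c - \<nu>) * (1 / \<nu>)"
        using mu nu by (intro add_left_mono mult_right_mono) auto
      also have "\<dots> = (1 / \<nu>) * c" using nu by (simp add: field_simps)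
      finally show ?thesis unfolding T_def using c nu by (simp add: pos_divide_le_eq)
    qed
    show "0 \<le> 1 / \<nu>" using nu by simp
    show "increasing (\<lambda>_. 0)" by (simp add: increasing_def)
    show "increasing (T g)" if g: "increasing g" "\<And>x. 0 \<le> g x" for g
      unfolding increasing_def
    proof (intro allI impI)
      fix z assume z: "Suc z < N"
      have step: "0 \<le> r * (g (Suc y) - g y)" if "r \<ge> 0" "Suc y < N" for r y
        using g(1) that by (auto simp: increasing_def)
      have low: "0 \<le> \<mu> * min (real z) M * (g z - g (z - 1))"
        using z mu M step[of "\<mu> * min (real z) M" "z - 1"] by (cases z) auto
      have far: "0 \<le> \<nu> * (real N - 2 - real z) * (g (Suc (Suc z)) - g (Suc z))"
        using z nu step[of "\<nu> * (real N - 2 - real z)" "Suc z"] by (cases "N = Suc (Suc z)") auto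
      have concave: "0 \<le> \<mu> * (2 * min (real (Suc z)) M - min (real z) M - min (real (Suc (Suc z))) M) * g z"
        using mu g(2) by (intro mult_nonneg_nonneg) (auto simp: min_def)
      have "num g (Suc z) - num g z =
          \<nu> * (real N - 2 - real z) * (g (Suc (Suc z)) - g (Suc z))
        + \<nu> * real z * (g (Suc z) - g z)
        + \<mu> * min (real z) M * (g z - g (z - 1))
        + \<mu> * (M - min (real (Suc (Suc z))) M) * (g (Suc z) - g z)
        + \<mu> * (2 * min (real (Suc z)) M - min (real z) M - min (real (Suc (Suc z))) M) * g z"
        unfolding num_def by (simp add: algebra_simps)
      also have "\<dots> \<ge> 0"
        using mu nu M z by (intro add_nonneg_nonneg far low concave step) auto
      finally show "T g z \<le> T g (Suc z)"
        unfolding T_def using z c by (auto intro: divide_right_mono)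
    qed
    show "increasing g" if X: "\<And>n. increasing (X n)" "\<And>x. (\<lambda>n. X n x) \<longlonglongrightarrow> g x" for X g
      unfolding increasing_def
      by (intro allI impI LIMSEQ_le[OF X(2) X(2)]) (use X(1) in \<open>auto simp: increasing_def\<close>)
  qed
  then obtain g where g: "T g = g" "\<And>x. 0 \<le> g x" "\<And>x. g x \<le> 1 / \<nu>" "increasing g" by blast
  \<comment> \<open>The fixed point equation says exactly that this expression is constant; in the full lot its
    value is the mean of \<open>Z\<^sub>f\<close>.\<close>
  define k where "k z = \<nu> * (real N - real z) * g z - \<mu> * min (real z) M * g (z - 1) + real z" for z
  have "k (Suc z) = k z" if "z < N" for z
  proof -
    have "g z = num g z / c" using that fun_cong[OF g(1), of z] by (simp add: T_def)
    then have "c * g z = num g z" using c by simp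
    then show ?thesis unfolding k_def num_def c_def by (simp add: algebra_simps)
  qed
  then have k: "k z = k 0" if "z \<le> N" for z using that by (induction z) auto
  show thesis
  proof (rule that)
    show "\<nu> * (real N - real z) * g z - \<mu> * min (real z) M * g (z - 1) = k 0 - real z" if "z \<le> N" for z
      using k[OF that] by (simp add: k_def)
  qed (use g in \<open>auto simp: increasing_def\<close>)
qed

lemma mean_Z_le_full_lot:
  assumes full: "stationary_distribution {0..N} (full_lot_rate \<mu> \<nu> N M) \<pi>f"
  shows "mean_Z \<le> measure_pmf.expectation \<pi>f real"
proof -
  obtain g e where g: "\<And>z. 0 \<le> g z" "\<And>z. g z \<le> 1 / \<nu>" "\<And>z. Suc z < N \<Longrightarrow> g z \<le> g (Suc z)"
    and e: "\<And>z. z \<le> N \<Longrightarrow> \<nu> * (real N - real z) * g z - \<mu> * min (real z) M * g (z - 1) = e - real z"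
    using full_lot_slope by metis
  \<comment> \<open>Testing the full lot with the function whose increments are \<open>g\<close> identifies \<open>e\<close> as its mean.\<close>
  let ?h = "\<lambda>z. \<Sum>i<z. g i"
  have sup: "z \<le> N" if "z \<in> set_pmf \<pi>f" for z
    using full that unfolding stationary_distribution_def by auto
  have gen: "(\<Sum>y\<in>{0..N} - {z}. full_lot_rate \<mu> \<nu> N M z y * (?h y - ?h z)) = e - real z" if "z \<le> N" for z
  proof -
    have "full_lot_rate \<mu> \<nu> N M z y * (?h y - ?h z) =
        (if y = Suc z then \<nu> * (real N - real z) * g z else 0)
        - (if y = z - 1 then \<mu> * min (real z) M * g (z - 1) else 0)" if "y \<noteq> z" for y
      using M that by (cases z) (auto simp: full_lot_rate_def algebra_simps)
    then have "(\<Sum>y\<in>{0..N} - {z}. full_lot_rate \<mu> \<nu> N M z y * (?h y - ?h z)) =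
        (\<Sum>y\<in>{0..N} - {z}. (if y = Suc z then \<nu> * (real N - real z) * g z else 0)
        - (if y = z - 1 then \<mu> * min (real z) M * g (z - 1) else 0))"
      by (intro sum.cong) auto
    also have "\<dots> = \<nu> * (real N - real z) * g z - \<mu> * min (real z) M * g (z - 1)"
      unfolding sum_subtractf using that M by (cases "z = N"; cases z) (auto simp: sum.delta)
    finally show ?thesis using e[OF that] by simp
  qed
  have int: "integrable (measure_pmf \<pi>f) real"
    by (rule integrable_measure_pmf_finite) (rule finite_subset[of _ "{..N}"], use sup in auto)
  have "measure_pmf.expectation \<pi>f (\<lambda>z. e - real z) =
      measure_pmf.expectation \<pi>f (\<lambda>z. \<Sum>y\<in>{0..N} - {z}. full_lot_rate \<mu> \<nu> N M z y * (?h y - ?h z))"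
    by (rule integral_cong_AE) (auto intro!: AE_pmfI simp: gen dest: sup)
  also have "\<dots> = 0" by (rule stationary_finite_balance[OF full]) simp
  finally have ef: "measure_pmf.expectation \<pi>f real = e" using int by simp
  let ?chg = "\<lambda>x. \<nu> * (real (fst x) - real (snd x)) * g (snd x)"
  let ?pow = "\<lambda>x. \<mu> * min (real (snd x)) M * g (snd x - 1)"
  have "0 \<le> E ?chg - E ?pow" using charged_flow_bound[of g "1 / \<nu>"] g by simp
  also have "\<dots> = E (\<lambda>x. ?chg x - ?pow x)" using integrable_any by simp
  also have "\<dots> \<le> E (\<lambda>x. e - real (snd x))"
  proof (rule expectation_mono)
    fix q z assume qz: "z \<le> q" "q \<le> N"
    have "\<nu> * (real q - real z) * g z \<le> \<nu> * (real N - real z) * g z"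
      using qz nu g(1) by (intro mult_right_mono mult_left_mono) auto
    then show "?chg (q, z) - ?pow (q, z) \<le> e - real (snd (q, z))" using e[of z] qz by simp
  qed
  also have "\<dots> = e - mean_Z" unfolding mean_Z_def using integrable_any by simp
  finally show ?thesis using ef by simp
qed

end

section \<open>Comparison of different lots and capacities\<close>

text \<open>
  Up-crossings of \<open>Z\<close> occur only while a space is free, down-crossings also while the lot is full.
  Therefore the law of \<open>Z\<close> given a free space is dominated, in the likelihood ratio order, by the law
  of \<open>Z\<close> in the infinite lot, where a space is always free.
\<close>

lemma charging_ratio_finite_vs_infinite:
  assumes fin: "charging_station lam \<mu> \<nu> (enat N) M \<pi>" and inf: "charging_station lam \<mu> \<nu> \<infinity> M \<rho>"
    and N: "N > 0"
  shows "mean_C \<rho> / mean_Q \<rho> \<le> mean_C \<pi> / mean_Q \<pi>"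
proof -
  interpret F: finite_charging_station lam \<mu> \<nu> N M \<pi>
    using fin N by (simp add: finite_charging_station_def finite_charging_station_axioms_def)
  interpret I: charging_station lam \<mu> \<nu> \<infinity> M \<rho> by fact
  let ?w = "F.mean_wait"
  define p where "p = map_pmf snd \<rho>"
  define r where "r j = measure_pmf.prob \<pi> (F.open_states \<inter> {x. snd x = j})" for j
  have p: "pmf p j = measure_pmf.prob \<rho> {x. snd x = j}" for j
    unfolding p_def by (auto simp: pmf_map vimage_def intro!: arg_cong2[where f=measure])
  have I_open: "I.open_states = UNIV" by (simp add: I.open_states_def)
  have p_flow: "lam * pmf p j = F.departure_rate (Suc j) * pmf p (Suc j)" for j
    using I.cut_flow[of j] unfolding I_open by (simp add: p)
  have r_flow: "lam * r j \<ge> F.departure_rate (Suc j) * r (Suc j)" for j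
    unfolding r_def F.cut_flow using F.departure_rate_pos[of j]
    by (intro mult_left_mono measure_pmf.finite_measure_mono) auto
  have p_pos: "pmf p j > 0" for j
  proof -
    have step: "pmf p (Suc i) = lam / F.departure_rate (Suc i) * pmf p i" for i
      using p_flow[of i] F.departure_rate_pos[of i] by (simp add: field_simps)
    have "pmf p 0 \<noteq> 0"
    proof
      assume "pmf p 0 = 0"
      then have "pmf p i = 0" for i by (induction i) (auto simp only: step mult_zero_right)
      then show False using set_pmf_not_empty[of p] by (auto simp: set_pmf_eq)
    qed
    then have "pmf p 0 > 0" using pmf_nonneg[of p 0] by linarith
    then show ?thesis
    proof (induction j)
      case (Suc j)
      then show ?case unfolding step
        using F.lam F.departure_rate_pos[of j] by (intro mult_pos_pos divide_pos_pos) auto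
    qed
  qed
  define x where "x j = r j / pmf p j" for j
  have "antimono x"
  proof (rule decseq_SucI)
    fix j
    have "x (Suc j) = (F.departure_rate (Suc j) * r (Suc j)) / (F.departure_rate (Suc j) * pmf p (Suc j))"
      unfolding x_def using F.departure_rate_pos[of j] by simp
    also have "\<dots> \<le> (lam * r j) / (lam * pmf p j)"
      unfolding p_flow[symmetric] using r_flow p_pos[of j] F.lam by (intro divide_right_mono) auto
    also have "\<dots> = x j" unfolding x_def using F.lam by simp
    finally show "x (Suc j) \<le> x j" .
  qed
  have r_zero: "r j = 0" if "j \<ge> N" for j
    unfolding r_def by (rule F.prob_open_high[OF that])
  have xp: "measure_pmf.expectation p (\<lambda>j. x j * f j) = F.E (\<lambda>y. indicator F.open_states y * f (snd y))"
    for f :: "nat \<Rightarrow> real"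
  proof -
    have "measure_pmf.expectation p (\<lambda>j. x j * f j) = (\<Sum>j<N. (x j * f j) * pmf p j)"
      by (rule integral_measure_pmf_real) (auto simp: x_def r_zero not_le[symmetric])
    also have "\<dots> = (\<Sum>j<N. f j * r j)"
      unfolding x_def using p_pos by (intro sum.cong refl) (simp add: less_imp_neq[symmetric])
    also have "\<dots> = F.E (\<lambda>y. indicator F.open_states y * f (snd y))"
      unfolding r_def F.expectation_open ..
    finally show ?thesis .
  qed
  have x_bounds: "0 \<le> x j" "x j \<le> x 0" for j
    using p_pos[of j] antimonoD[OF \<open>antimono x\<close>, of 0 j] by (auto simp: x_def r_def)
  have "measure_pmf.expectation p (\<lambda>j. x j * ?w j) \<le>
      measure_pmf.expectation p x * measure_pmf.expectation p ?w"
  proof (rule expectation_antimono_mono)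
    show "integrable (measure_pmf p) x"
      using x_bounds by (intro measure_pmf.integrable_const_bound[where B="x 0"]) auto
    show "integrable (measure_pmf p) ?w"
      using F.mean_wait_bounds by (intro measure_pmf.integrable_const_bound[where B="1 / \<nu>"]) auto
    have "\<bar>x j * ?w j\<bar> \<le> x 0 * (1 / \<nu>)" for j
      unfolding abs_mult using x_bounds[of j] F.mean_wait_bounds[of j] by (intro mult_mono) auto
    then show "integrable (measure_pmf p) (\<lambda>j. x j * ?w j)"
      by (intro measure_pmf.integrable_const_bound[where B="x 0 * (1 / \<nu>)"]) auto
  qed (rule \<open>antimono x\<close> F.mono_mean_wait)+
  moreover have "measure_pmf.expectation p x = measure_pmf.prob \<pi> F.open_states"
    using xp[of "\<lambda>_. 1"] by simp
  moreover have "measure_pmf.expectation p ?w = I.E (\<lambda>y. ?w (snd y))"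
    unfolding p_def by (simp add: integral_map_pmf)
  ultimately have key: "F.E (\<lambda>y. indicator F.open_states y * ?w (snd y)) \<le>
      measure_pmf.prob \<pi> F.open_states * I.E (\<lambda>y. ?w (snd y))"
    unfolding xp by simp
  define P where "P = measure_pmf.prob \<pi> F.open_states"
  define A where "A = F.E (\<lambda>y. indicator F.open_states y * ?w (snd y))"
  define B where "B = I.E (\<lambda>y. ?w (snd y))"
  have Q: "mean_Q \<pi> = lam * P / \<nu>" "mean_Q \<rho> = lam / \<nu>"
    using F.mean_Q_flow I.mean_Q_flow F.nu unfolding P_def I_open by (auto simp: field_simps)
  have Z: "F.mean_Z = lam * A" "I.mean_Z = lam * B"
    using F.mean_Z_flow I.mean_Z_flow unfolding A_def B_def I_open by simp_all
  have "P > 0" unfolding P_def by (rule F.prob_open_pos)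
  then have "mean_C \<pi> / mean_Q \<pi> = 1 - \<nu> * (A / P)" "mean_C \<rho> / mean_Q \<rho> = 1 - \<nu> * B"
    unfolding F.mean_C_eq I.mean_C_eq Q Z using F.lam F.nu by (auto simp: field_simps)
  moreover have "A / P \<le> B" using key \<open>P > 0\<close> unfolding A_def B_def P_def by (simp add: divide_le_eq mult.commute)
  then have "\<nu> * (A / P) \<le> \<nu> * B" using F.nu by (intro mult_left_mono) auto
  ultimately show ?thesis by linarith
qed

text \<open>
  \<open>Q\<close> is an Erlang loss system: its flow equation determines its law and does not contain the
  charging parameters.
\<close>

lemma mean_Q_capacity_independent:
  assumes "charging_station lam \<mu> \<nu> K M \<pi>" and "charging_station lam \<mu>' \<nu> K M' \<pi>'"
  shows "mean_Q \<pi> = mean_Q \<pi>'"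
proof -
  interpret A: charging_station lam \<mu> \<nu> K M \<pi> by fact
  interpret B: charging_station lam \<mu>' \<nu> K M' \<pi>' by fact
  have pQ: "measure_pmf.prob \<rho> {x. fst x = n} = pmf (map_pmf fst \<rho>) n" for \<rho> :: "(nat \<times> nat) pmf" and n
    by (auto simp: pmf_map vimage_def intro!: arg_cong2[where f=measure])
  have "map_pmf fst \<pi> = map_pmf fst \<pi>'"
    by (rule pmf_nat_eqI[where a="\<lambda>n. \<nu> * real n" and b="\<lambda>n. if enat n < K then lam else 0"])
       (use A.pQ_flow B.pQ_flow A.nu in \<open>auto simp: A.pQ_def B.pQ_def pQ\<close>)
  then have "measure_pmf.expectation (map_pmf fst \<pi>) real = measure_pmf.expectation (map_pmf fst \<pi>') real"
    by simp
  then show ?thesis by (simp add: mean_Q_def case_prod_unfold integral_map_pmf)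
qed

lemma mean_C_le_full_capacity:
  assumes "finite_charging_station lam \<mu> \<nu> N M \<pi>" and "finite_charging_station lam \<mu> \<nu> N (real N) \<pi>'"
  shows "mean_C \<pi> \<le> mean_C \<pi>'"
proof -
  interpret A: finite_charging_station lam \<mu> \<nu> N M \<pi> by fact
  interpret B: finite_charging_station lam \<mu> \<nu> N "real N" \<pi>' by fact
  have Q: "mean_Q \<pi> = mean_Q \<pi>'"
    by (rule mean_Q_capacity_independent) unfold_locales
  have "A.E (\<lambda>x. min (real (snd x)) M) \<le> A.mean_Z"
    unfolding A.mean_Z_def by (rule A.expectation_mono) auto
  then have "\<nu> * mean_C \<pi> \<le> \<mu> * (mean_Q \<pi> - mean_C \<pi>)"
    unfolding A.mean_C_flow using A.mean_C_eq A.mu by (simp add: mult_left_mono)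
  moreover have "B.E (\<lambda>x. min (real (snd x)) (real N)) = B.mean_Z"
    unfolding B.mean_Z_def
    by (rule antisym; rule B.expectation_mono) auto
  then have "\<nu> * mean_C \<pi>' = \<mu> * (mean_Q \<pi>' - mean_C \<pi>')"
    unfolding B.mean_C_flow using B.mean_C_eq by simp
  ultimately have "(\<mu> + \<nu>) * mean_C \<pi> \<le> (\<mu> + \<nu>) * mean_C \<pi>'"
    unfolding Q by (simp add: algebra_simps)
  then show ?thesis using A.mu A.nu by simp
qed

theorem proposition3p1:
  fixes lam \<mu> \<nu> M :: real and K :: nat
    and \<pi>_K_M \<pi>_inf_M \<pi>_K_K :: "(nat \<times> nat) pmf" and \<pi>_f :: "nat pmf"
  assumes "lam > 0" and "\<mu> > 0" and "\<nu> > 0"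
    and "K > 0" and "0 < M" and "M \<le> real K"
    and "stationary_distribution (charging_states (enat K))
           (charging_rate lam \<mu> \<nu> (enat K) M) \<pi>_K_M"
    and "stationary_distribution (charging_states \<infinity>)
           (charging_rate lam \<mu> \<nu> \<infinity> M) \<pi>_inf_M"
    and "stationary_distribution (charging_states (enat K))
           (charging_rate lam \<mu> \<nu> (enat K) (real K)) \<pi>_K_K"
    and "stationary_distribution {0..K} (full_lot_rate \<mu> \<nu> K M) \<pi>_f"
  shows "mean_C \<pi>_inf_M / mean_Q \<pi>_inf_M \<le> mean_C \<pi>_K_M / mean_Q \<pi>_K_M
       \<and> mean_C \<pi>_K_M / mean_Q \<pi>_K_M \<le> mean_C \<pi>_K_K / mean_Q \<pi>_K_M
       \<and> (mean_Q \<pi>_K_M - measure_pmf.expectation \<pi>_f real) / mean_Q \<pi>_K_M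
           \<le> mean_C \<pi>_K_M / mean_Q \<pi>_K_M"
proof -
  note locale_rules = finite_charging_station.intro finite_charging_station_axioms.intro
    charging_station.intro
  interpret F: finite_charging_station lam \<mu> \<nu> K M \<pi>_K_M
    by (intro locale_rules assms(1-5,7))
  interpret I: charging_station lam \<mu> \<nu> \<infinity> M \<pi>_inf_M
    by (intro locale_rules assms(1-3,5,8))
  have "0 < real K" using assms(4) by simp
  then interpret B: finite_charging_station lam \<mu> \<nu> K "real K" \<pi>_K_K
    by (intro locale_rules assms(1-4,9))
  have nonneg: "0 \<le> mean_Q \<pi>_K_M"
    unfolding mean_Q_def by (intro Bochner_Integration.integral_nonneg) auto
  have "mean_C \<pi>_inf_M / mean_Q \<pi>_inf_M \<le> mean_C \<pi>_K_M / mean_Q \<pi>_K_M"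
    by (rule charging_ratio_finite_vs_infinite) (unfold_locales, fact)
  moreover have "mean_C \<pi>_K_M \<le> mean_C \<pi>_K_K"
    by (rule mean_C_le_full_capacity) unfold_locales
  moreover have "mean_Q \<pi>_K_M - measure_pmf.expectation \<pi>_f real \<le> mean_C \<pi>_K_M"
    using F.mean_Z_le_full_lot[OF assms(10)] unfolding F.mean_C_eq by simp
  ultimately show ?thesis using nonneg by (auto intro: divide_right_mono)
qed

end
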